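(* Let $N\ge 2$, $M\ge 2$ be integers with $M\ge N$, let $0<r\le 1/N$, let $\{f_1,\dots,f_N\}$ be an IFS on $[0,1]$ with attractor $C$ as in the context, let $\mathbf p=(1/N,\dots,1/N)$, and let $F=F(\omega)$ be the random set defined in the context. Then, for $\mu_{\mathbf p}$-almost every $\omega$, $$\dim_H F(\omega)=\dim_B F(\omega)=\dim_H C=-\frac{\log N}{\log r}.$$
   Context: IFS: $f_i:[0,1]\to[0,1]$, $f_i(x)=rx+b_i$ for $i=1,\dots,N$, with constants $b_i$ such that the open intervals $f_i((0,1))$ are pairwise disjoint and $f_i([0,1])$ lies to the left of $f_j([0,1])$ when $i<j$. $C$ is the attractor, i.e. the unique nonempty compact set with $C=\bigcup_{i=1}^N f_i(C)$. Probability space: $\Omega=\{1,\dots,N\}^{\mathbb N}$ ($\mathbb N=\{1,2,\dots\}$) with its Borel $\sigma$-algebra and the product measure $\mu_{\mathbf p}$ under which the coordinates $\omega_1,\omega_2,\dots$ are i.i.d. with $\mu_{\mathbf p}(\omega_k=i)=p_i$ (here $p_i=1/N$). Tree: let $\mathcal I_n=\{1,\dots,M\}^n$, $\mathcal I_0=\{\epsilon\}$ with $\epsilon$ the empty word, $\mathcal I^*=\bigcup_{n\ge0}\mathcal I_n$, and $\mathcal I=\{1,\dots,M\}^{\mathbb N}$. Order $\mathcal I^*$ by: $\mathbf i<_*\mathbf j$ if $\mathbf i$ is shorter than $\mathbf j$, or if they have equal length and $\mathbf i$ precedes $\mathbf j$ lexicographically. Put $\kappa(\mathbf i)=\#\{\mathbf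 j\in\mathcal I^*:\mathbf j<_*\mathbf i\}$, so that $\kappa$ maps the nonempty words bijectively onto $\mathbb N$. For nonempty $\mathbf i\in\mathcal I^*$ let $X_{\mathbf i}(\omega)=\omega_{\kappa(\mathbf i)}$ (the random label of the edge of the $M$-ary tree leading to the node $\mathbf i$). Random set: writing $\mathbf i|_k=(i_1,\dots,i_k)$, $$F(\omega)=\Big\{x:\ \{x\}=\bigcap_{n\ge1} f_{X_{\mathbf i|_1}(\omega)}\circ f_{X_{\mathbf i|_2}(\omega)}\circ\dots\circ f_{X_{\mathbf i|_n}(\omega)}([0,1])\ \text{ for some }\mathbf i\in\mathcal I\Big\}.$$ $\dim_H$ and $\dim_B$ are Hausdorff and box-counting dimension (the claim includes that the box-counting dimension exists). *)

theory Defs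
  imports "HOL-Probability.Probability"
begin

section \<open>Hausdorff dimension\<close>

text \<open>
  The summand (diam U)^s with the usual conventions at s = 0: nonempty sets count 1
  (whereas \<^term>\<open>0 powr 0 = (0::real)\<close>), and the empty set counts 0, so that finite covers
  can be padded to sequences.
\<close>
definition diam_pow :: "real \<Rightarrow> 'a::metric_space set \<Rightarrow> ennreal" where
  "diam_pow s U =
     (if U = {} then 0 else if s = 0 then 1 else ennreal (diameter U powr s))"

text \<open>Boundedness is required because \<^const>\<open>diameter\<close> is unspecified on unbounded sets.\<close>
definition hausdorff_premeasure :: "real \<Rightarrow> real \<Rightarrow> 'a::metric_space set \<Rightarrow> ennreal" where
  "hausdorff_premeasure s \<delta> A =
     (INF U \<in> {U :: nat \<Rightarrow> 'a set. A \<subseteq> (\<Union>n. U n) \<and> (\<forall>n. bounded (U n) \<and> diameter (U n) \<le> \<delta>)}.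
        \<Sum>n. diam_pow s (U n))"

definition hausdorff_measure :: "real \<Rightarrow> 'a::metric_space set \<Rightarrow> ennreal" where
  "hausdorff_measure s A = (SUP \<delta> \<in> {0<..}. hausdorff_premeasure s \<delta> A)"

definition hausdorff_dim :: "'a::metric_space set \<Rightarrow> ereal" where
  "hausdorff_dim A = Inf {ereal s | s. 0 \<le> s \<and> hausdorff_measure s A = 0}"


section \<open>Box-counting dimension\<close>

text \<open>The least number of sets of diameter at most \<open>\<delta>\<close> that cover \<open>A\<close> (for bounded \<open>A\<close>).\<close>
definition covering_number :: "real \<Rightarrow> 'a::euclidean_space set \<Rightarrow> nat" where
  "covering_number \<delta> A =
     (LEAST n. \<exists>\<U>. finite \<U> \<and> card \<U> = n \<and> A \<subseteq> \<Union>\<U> \<and>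
                    (\<forall>U\<in>\<U>. bounded U \<and> diameter U \<le> \<delta>))"

definition lower_box_dim :: "'a::euclidean_space set \<Rightarrow> ereal" where
  "lower_box_dim A =
     Liminf (at_right 0) (\<lambda>\<delta>. ereal (ln (real (covering_number \<delta> A)) / - ln \<delta>))"

definition upper_box_dim :: "'a::euclidean_space set \<Rightarrow> ereal" where
  "upper_box_dim A =
     Limsup (at_right 0) (\<lambda>\<delta>. ereal (ln (real (covering_number \<delta> A)) / - ln \<delta>))"

text \<open>The box-counting dimension of \<open>A\<close> exists and equals \<open>d\<close>.\<close>
definition has_box_dim :: "'a::euclidean_space set \<Rightarrow> ereal \<Rightarrow> bool" where
  "has_box_dim A d \<longleftrightarrow> A \<noteq> {} \<and> bounded A \<and> lower_box_dim A = d \<and> upper_box_dim A = d"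


section \<open>Iterated function systems on the unit interval\<close>

definition is_attractor :: "nat \<Rightarrow> (nat \<Rightarrow> real \<Rightarrow> real) \<Rightarrow> real set \<Rightarrow> bool" where
  "is_attractor N f C \<longleftrightarrow>
     C \<subseteq> {0..1} \<and> C \<noteq> {} \<and> compact C \<and> C = (\<Union>i\<in>{1..N}. f i ` C)"

text \<open>\<open>compose_word f [a\<^sub>1, \<dots>, a\<^sub>n] = f a\<^sub>1 \<circ> \<dots> \<circ> f a\<^sub>n\<close>\<close>
definition compose_word :: "(nat \<Rightarrow> real \<Rightarrow> real) \<Rightarrow> nat list \<Rightarrow> real \<Rightarrow> real" where
  "compose_word f w = foldr (\<circ>) (map f w) id"


section \<open>The random set\<close>

text \<open>The sequence space \<open>{1..N}\<close> to the power \<open>{1,2,\<dots>}\<close> with the i.i.d. product measure.\<close>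
definition label_measure :: "nat \<Rightarrow> (nat \<Rightarrow> real) \<Rightarrow> (nat \<Rightarrow> nat) measure" where
  "label_measure N p = (\<Pi>\<^sub>M k\<in>{1..}. point_measure {1..N} (\<lambda>i. ennreal (p i)))"

text \<open>
  \<^term>\<open>lenlex less_than\<close> compares words first by length, then lexicographically.
\<close>
definition kappa :: "nat \<Rightarrow> nat list \<Rightarrow> nat" where
  "kappa M w = card {v \<in> lists {1..M}. (v, w) \<in> lenlex less_than}"

definition edge_label :: "nat \<Rightarrow> (nat \<Rightarrow> nat) \<Rightarrow> nat list \<Rightarrow> nat" where
  "edge_label M \<omega> w = \<omega> (kappa M w)"

text \<open>Infinite words are indexed from 1; the value at index 0 is never used.\<close>
definition word_prefix :: "(nat \<Rightarrow> nat) \<Rightarrow> nat \<Rightarrow> nat list" where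
  "word_prefix \<sigma> k = map \<sigma> [1..<Suc k]"

definition random_set :: "nat \<Rightarrow> (nat \<Rightarrow> real \<Rightarrow> real) \<Rightarrow> (nat \<Rightarrow> nat) \<Rightarrow> real set" where
  "random_set M f \<omega> =
     {x. \<exists>\<sigma> \<in> {1..} \<rightarrow> {1..M}.
        {x} = (\<Inter>n\<in>{1..}.
           compose_word f (map (\<lambda>k. edge_label M \<omega> (word_prefix \<sigma> k)) [1..<Suc n]) ` {0..1})}"

end

theory Submission
  imports Defs "HOL-Real_Asymp.Real_Asymp"
begin

text \<open>
  Write \<open>s = - ln N / ln r\<close>. Every point of the random set lies in nested cells of the system, so the random
  set is contained in the attractor \<open>C\<close>. The attractor is covered by the \<open>N ^ n\<close> cells of level \<open>n\<close>, of length
  \<open>r ^ n\<close>, which bounds the upper box dimension of all its nonempty subsets by \<open>s\<close>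
  (\<open>upper_box_dim_subset_attractor\<close>). Hausdorff dimension never exceeds lower box dimension
  (\<open>hausdorff_dim_le_lower_box_dim\<close>). All dimensions in question are therefore squeezed to \<open>s\<close> as soon as
  the random set has Hausdorff dimension at least \<open>s\<close> almost surely.

  For this lower bound, choose a ray of the tree uniformly at random and follow it to its point in the random
  set. The rays whose labels begin with a word \<open>w\<close> of length \<open>n\<close> have mass \<open>M ^ (- n)\<close> times the number
  of nodes whose path reads \<open>w\<close>, and their points lie in the cell of \<open>w\<close>. The sum of the squares of these masses is \<open>M ^ (- 2 n)\<close> times the number
  of pairs of nodes with equal label words. Two paths that separate after level \<open>m\<close> agree in their labels with
  probability \<open>N ^ (- (n - m))\<close>, and a pair separates after level \<open>m\<close> or later with probability \<open>M ^ (- m)\<close>.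
  Because \<open>M \<ge> N\<close>, the expected sum of squares is at most \<open>(n + 1) * N ^ (- n)\<close>
  (\<open>expected_collisions_le\<close>): up to a polynomial factor this is the value for mass spread evenly over all
  cells. A first moment argument makes this bound almost sure, simultaneously for all \<open>n\<close>
  (\<open>AE_collisions_bounded\<close>). The mass is then too spread out to be covered cheaply
  with an exponent below \<open>s\<close> (\<open>hausdorff_measure_random_set_pos\<close>).
\<close>

section \<open>Comparison of Hausdorff and box-counting dimension\<close>

lemma hausdorff_premeasure_mono:
  assumes "A \<subseteq> B"
  shows "hausdorff_premeasure s \<delta> A \<le> hausdorff_premeasure s \<delta> B"
  unfolding hausdorff_premeasure_def using assms by (intro INF_superset_mono) auto

lemma hausdorff_dim_mono:
  assumes "A \<subseteq> B"
  shows "hausdorff_dim A \<le> hausdorff_dim B"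
proof -
  have "hausdorff_measure s A \<le> hausdorff_measure s B" for s
    unfolding hausdorff_measure_def
    by (intro SUP_mono) (use hausdorff_premeasure_mono[OF assms] in blast)
  then have "hausdorff_measure s A = 0" if "hausdorff_measure s B = 0" for s
    using that by (metis le_zero_eq)
  then show ?thesis
    unfolding hausdorff_dim_def by (intro Inf_superset_mono) auto
qed

lemma hausdorff_dim_ge:
  assumes "\<And>t. 0 \<le> t \<Longrightarrow> t < s \<Longrightarrow> hausdorff_measure t A \<noteq> 0"
  shows "ereal s \<le> hausdorff_dim A"
  unfolding hausdorff_dim_def using assms by (intro Inf_greatest) (force simp: not_less[symmetric])

lemma hausdorff_premeasure_le_finite_cover:
  fixes A :: "'a::metric_space set"
  assumes "finite \<U>" "A \<subseteq> \<Union>\<U>" "\<And>U. U \<in> \<U> \<Longrightarrow> bounded U \<and> diameter U \<le> \<delta>"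
    and "0 < t" "\<delta> \<le> \<epsilon>" "0 \<le> \<epsilon>"
  shows "hausdorff_premeasure t \<epsilon> A \<le> of_nat (card \<U>) * ennreal (\<delta> powr t)"
proof -
  obtain h where h: "bij_betw h {..<card \<U>} \<U>"
    using ex_bij_betw_nat_finite[OF assms(1)] by (auto simp: atLeast0LessThan)
  define U where "U k = (if k < card \<U> then h k else {})" for k
  have im: "h k \<in> \<U>" if "k < card \<U>" for k
    using h that by (auto simp: bij_betw_def)
  have "A \<subseteq> (\<Union>k. U k)"
  proof
    fix x assume "x \<in> A"
    then obtain V where "V \<in> \<U>" "x \<in> V" using assms(2) by blast
    then have "V \<in> h ` {..<card \<U>}" using h by (simp add: bij_betw_def)
    then obtain k where "k < card \<U>" "h k = V" by auto
    then show "x \<in> (\<Union>k. U k)" using \<open>x \<in> V\<close> by (auto simp: U_def)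
  qed
  moreover have "bounded (U k) \<and> diameter (U k) \<le> \<epsilon>" for k
    using assms(3)[OF im, of k] assms(5,6) by (auto simp: U_def)
  ultimately have "hausdorff_premeasure t \<epsilon> A \<le> (\<Sum>k. diam_pow t (U k))"
    unfolding hausdorff_premeasure_def by (intro INF_lower) auto
  also have "\<dots> = (\<Sum>k<card \<U>. diam_pow t (U k))"
    by (rule suminf_finite) (auto simp: U_def diam_pow_def)
  also have "\<dots> \<le> (\<Sum>k<card \<U>. ennreal (\<delta> powr t))"
  proof (rule sum_mono)
    fix k assume "k \<in> {..<card \<U>}"
    then have "bounded (h k)" "diameter (h k) \<le> \<delta>" using assms(3)[OF im] by auto
    then show "diam_pow t (U k) \<le> ennreal (\<delta> powr t)"
      using assms(4) diameter_ge_0[of "h k"]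
      by (auto simp: U_def diam_pow_def intro!: ennreal_leI powr_mono2)
  qed
  finally show ?thesis by simp
qed

lemma covering_number_attained:
  fixes A :: "'a::euclidean_space set"
  assumes "bounded A" "0 < \<delta>"
  obtains \<U> where "finite \<U>" "card \<U> = covering_number \<delta> A" "A \<subseteq> \<Union>\<U>"
    "\<And>U. U \<in> \<U> \<Longrightarrow> bounded U \<and> diameter U \<le> \<delta>"
proof -
  have "compact (closure A)" using assms(1) by (simp add: compact_closure)
  then obtain K where K: "finite K" "closure A \<subseteq> (\<Union>x\<in>K. ball x (\<delta>/2))"
    using assms(2) unfolding compact_eq_totally_bounded by (meson half_gt_zero)
  have "A \<subseteq> \<Union>((\<lambda>x. ball x (\<delta>/2)) ` K)" using K(2) closure_subset by blast
  moreover have "\<forall>U\<in>(\<lambda>x. ball x (\<delta>/2)) ` K. bounded U \<and> diameter U \<le> \<delta>"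
    using assms(2) by (auto simp: diameter_ball)
  ultimately have "\<exists>n \<U>. finite \<U> \<and> card \<U> = n \<and> A \<subseteq> \<Union>\<U> \<and> (\<forall>U\<in>\<U>. bounded U \<and> diameter U \<le> \<delta>)"
    using K(1) by blast
  from LeastI_ex[OF this] show ?thesis
    using that unfolding covering_number_def by blast
qed

lemma covering_number_le:
  assumes "finite \<U>" "A \<subseteq> \<Union>\<U>" "\<And>U. U \<in> \<U> \<Longrightarrow> bounded U \<and> diameter U \<le> \<delta>"
  shows "covering_number \<delta> A \<le> card \<U>"
  unfolding covering_number_def using assms by (intro Least_le) blast

lemma covering_number_pos:
  fixes A :: "'a::euclidean_space set"
  assumes "bounded A" "A \<noteq> {}" "0 < \<delta>"
  shows "0 < covering_number \<delta> A"
  using covering_number_attained[OF assms(1,3)] assms(2) by (metis Union_empty card_gt_0_iff subset_empty)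

text \<open>
  If the lower box dimension is below \<open>t' < t\<close>, then at arbitrarily small scales \<open>\<delta>\<close> the set is covered by
  at most \<open>\<delta> powr (- t')\<close> sets of diameter at most \<open>\<delta>\<close>. Their \<open>t\<close>-th powers sum to at most
  \<open>\<delta> powr (t - t')\<close>, which tends to 0, so the \<open>t\<close>-dimensional Hausdorff measure vanishes.
\<close>
lemma hausdorff_dim_le_lower_box_dim:
  fixes A :: "'a::euclidean_space set"
  assumes "bounded A" "A \<noteq> {}"
  shows "hausdorff_dim A \<le> lower_box_dim A"
proof (rule ccontr)
  assume "\<not> ?thesis"
  then obtain t' where t': "lower_box_dim A < ereal t'" "ereal t' < hausdorff_dim A"
    using ereal_dense2 by (metis not_le)
  then obtain t where t: "t' < t" "ereal t < hausdorff_dim A"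
    using ereal_dense2 by (metis less_ereal.simps(1))
  define g where "g \<delta> = ln (real (covering_number \<delta> A)) / - ln \<delta>" for \<delta>
  have fr: "\<exists>\<^sub>F \<delta> in at_right 0. g \<delta> < t'"
  proof (rule ccontr)
    assume "\<not> ?thesis"
    then have "\<forall>\<^sub>F \<delta> in at_right 0. ereal t' \<le> ereal (g \<delta>)"
      by (simp add: not_frequently not_less)
    then have "ereal t' \<le> lower_box_dim A"
      unfolding lower_box_dim_def g_def by (rule Liminf_bounded)
    then show False using t' by simp
  qed
  have good: "\<exists>\<delta>. 0 < \<delta> \<and> \<delta> < 1 \<and> \<delta> < \<epsilon> \<and> g \<delta> < t' \<and> \<delta> powr (t - t') < \<eta>"
    if "0 < \<epsilon>" "0 < \<eta>" for \<epsilon> \<eta>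
  proof -
    have "((\<lambda>\<delta>::real. \<delta> powr (t - t')) \<longlongrightarrow> 0) (at_right 0)"
      using t(1) by real_asymp
    then have "\<forall>\<^sub>F \<delta> in at_right 0. \<delta> powr (t - t') < \<eta>"
      using that(2) by (rule order_tendstoD(2))
    moreover have "\<forall>\<^sub>F \<delta> in at_right 0. \<delta> \<in> {0<..<min 1 \<epsilon>}"
      using that(1) by (intro eventually_at_rightI[of 0 "min 1 \<epsilon>"]) auto
    ultimately have "\<forall>\<^sub>F \<delta> in at_right 0. \<delta> powr (t - t') < \<eta> \<and> \<delta> \<in> {0<..<min 1 \<epsilon>}"
      by eventually_elim auto
    from frequently_ex[OF frequently_eventually_conj[OF fr this]] show ?thesis by auto
  qed
  have bound: "real (covering_number \<delta> A) \<le> \<delta> powr (- t')" if "0 < \<delta>" "\<delta> < 1" "g \<delta> < t'" for \<delta>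
  proof -
    have "ln (real (covering_number \<delta> A)) \<le> t' * - ln \<delta>"
      using that pos_divide_less_eq[of "- ln \<delta>" "ln (real (covering_number \<delta> A))" t'] by (simp add: g_def)
    then show ?thesis
      using covering_number_pos[OF assms that(1)] that(1)
      by (subst ln_le_cancel_iff[symmetric]) (auto simp: ln_powr)
  qed
  \<comment> \<open>Covering numbers are at least 1, so the box-counting quotient is nonnegative at scales below 1.\<close>
  have "0 < t"
  proof -
    obtain \<delta> where d: "0 < \<delta>" "\<delta> < 1" "g \<delta> < t'" using good[of 1 1] by auto
    have "0 \<le> g \<delta>" unfolding g_def
      using d covering_number_pos[OF assms d(1)] by (intro divide_nonneg_nonneg ln_ge_zero) auto
    then show ?thesis using d t by simp
  qed
  have "hausdorff_premeasure t \<epsilon> A = 0" if "0 < \<epsilon>" for \<epsilon>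
  proof -
    have "hausdorff_premeasure t \<epsilon> A \<le> ennreal \<eta>" if \<eta>: "0 < \<eta>" for \<eta>
    proof -
      obtain \<delta> where d: "0 < \<delta>" "\<delta> < 1" "\<delta> < \<epsilon>" "g \<delta> < t'" "\<delta> powr (t - t') < \<eta>"
        using good[OF \<open>0 < \<epsilon>\<close> \<eta>] by auto
      obtain \<U> where U: "finite \<U>" "card \<U> = covering_number \<delta> A" "A \<subseteq> \<Union>\<U>"
        "\<And>U. U \<in> \<U> \<Longrightarrow> bounded U \<and> diameter U \<le> \<delta>"
        using covering_number_attained[OF assms(1) d(1)] by metis
      have "hausdorff_premeasure t \<epsilon> A \<le> of_nat (card \<U>) * ennreal (\<delta> powr t)"
        using U d \<open>0 < t\<close> by (intro hausdorff_premeasure_le_finite_cover) auto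
      also have "\<dots> = ennreal (real (covering_number \<delta> A) * \<delta> powr t)"
        by (simp add: U ennreal_mult ennreal_of_nat_eq_real_of_nat)
      also have "\<dots> \<le> ennreal (\<delta> powr (- t') * \<delta> powr t)"
        by (intro ennreal_leI mult_right_mono bound d) auto
      also have "\<dots> = ennreal (\<delta> powr (t - t'))"
        by (simp add: powr_add[symmetric])
      also have "\<dots> \<le> ennreal \<eta>" using d by (intro ennreal_leI) auto
      finally show ?thesis .
    qed
    then have "hausdorff_premeasure t \<epsilon> A \<le> 0"
      by (intro ennreal_le_epsilon[where y = 0]) (simp only: add_0)
    then show ?thesis by (simp only: le_zero_eq)
  qed
  then have "hausdorff_measure t A = 0"
    unfolding hausdorff_measure_def by (intro SUP_eq_const) auto
  then have "hausdorff_dim A \<le> ereal t"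
    unfolding hausdorff_dim_def using \<open>0 < t\<close> by (intro Inf_lower) auto
  then show False using t by simp
qed

text \<open>
  For \<open>\<delta>\<close> between consecutive powers of \<open>r\<close> the exponent of the smaller power exceeds \<open>ln \<delta> / ln r\<close> by at
  most 1. This costs an additive \<open>ln N / - ln \<delta>\<close>, which vanishes as \<open>\<delta>\<close> tends to 0.
\<close>
lemma upper_box_dim_le_geometric_covers:
  fixes A :: "'a::euclidean_space set"
  assumes "1 \<le> N" "0 < r" "r < 1" "bounded A" "A \<noteq> {}"
    and cover: "\<And>n. \<exists>\<U>. finite \<U> \<and> card \<U> \<le> N ^ n \<and> A \<subseteq> \<Union>\<U> \<and> (\<forall>U\<in>\<U>. bounded U \<and> diameter U \<le> r ^ n)"
  shows "upper_box_dim A \<le> ereal (- (ln (real N) / ln r))"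
proof -
  let ?h = "\<lambda>\<delta>. - (ln (real N) / ln r) + ln (real N) / - ln \<delta>"
  have lr: "ln r < 0" using assms by simp
  have le: "ln (real (covering_number \<delta> A)) / - ln \<delta> \<le> ?h \<delta>" if d: "0 < \<delta>" "\<delta> < 1" for \<delta>
  proof -
    have ld: "ln \<delta> < 0" using d by simp
    define n where "n = nat \<lceil>ln \<delta> / ln r\<rceil>"
    have "0 \<le> ln \<delta> / ln r" using ld lr by (simp add: divide_nonpos_nonpos)
    then have n: "ln \<delta> / ln r \<le> real n" "real n \<le> ln \<delta> / ln r + 1"
      unfolding n_def by linarith+
    have "real n * ln r \<le> ln \<delta>" using n(1) lr by (simp add: field_simps)
    then have "ln (r ^ n) \<le> ln \<delta>" using assms by (simp add: ln_realpow)
    then have rn: "r ^ n \<le> \<delta>" using assms d by simp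
    obtain \<U> where U: "finite \<U>" "card \<U> \<le> N ^ n" "A \<subseteq> \<Union>\<U>" "\<forall>U\<in>\<U>. bounded U \<and> diameter U \<le> r ^ n"
      using cover by blast
    have "covering_number \<delta> A \<le> N ^ n"
      using covering_number_le[of \<U> A \<delta>] U rn by (meson order_trans)
    then have "real (covering_number \<delta> A) \<le> real N ^ n"
      by (metis of_nat_le_iff of_nat_power)
    then have "ln (real (covering_number \<delta> A)) \<le> ln (real N ^ n)"
      using covering_number_pos[OF assms(4,5) d(1)] assms(1) by (subst ln_le_cancel_iff) auto
    also have "\<dots> = real n * ln (real N)"
      using assms(1) by (simp add: ln_realpow)
    also have "\<dots> \<le> (ln \<delta> / ln r + 1) * ln (real N)"
      using n(2) assms(1) by (intro mult_right_mono) auto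
    finally have "ln (real (covering_number \<delta> A)) / - ln \<delta> \<le> (ln \<delta> / ln r + 1) * ln (real N) / - ln \<delta>"
      using ld by (intro divide_right_mono) auto
    also have "\<dots> = ?h \<delta>" using ld lr by (simp add: field_simps)
    finally show ?thesis .
  qed
  have "upper_box_dim A \<le> Limsup (at_right 0) (\<lambda>\<delta>. ereal (?h \<delta>))"
    unfolding upper_box_dim_def
    by (intro Limsup_mono eventually_at_rightI[of 0 1]) (use le in auto)
  also have "(?h \<longlongrightarrow> - (ln (real N) / ln r)) (at_right 0)"
    by real_asymp
  then have "Limsup (at_right 0) (\<lambda>\<delta>. ereal (?h \<delta>)) = ereal (- (ln (real N) / ln r))"
    by (intro lim_imp_Limsup) auto
  finally show ?thesis .
qed

lemma lower_box_dim_le_upper_box_dim: "lower_box_dim A \<le> upper_box_dim A"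
  unfolding lower_box_dim_def upper_box_dim_def by (rule Liminf_le_Limsup) simp

section \<open>Geometry of the cells of an ordered self-similar system\<close>

definition words :: "nat \<Rightarrow> nat \<Rightarrow> nat list set" where
  "words K n = {u \<in> lists {1..K}. length u = n}"

lemma words_eq: "words K n = {u. set u \<subseteq> {1..K} \<and> length u = n}"
  by (auto simp: words_def)

lemma finite_words [simp]: "finite (words K n)"
  unfolding words_eq by (rule finite_lists_length_eq) simp

lemma card_words [simp]: "card (words K n) = K ^ n"
  unfolding words_eq by (subst card_lists_length_eq) auto

lemma compose_word_Nil [simp]: "compose_word f [] x = x"
  and compose_word_Cons [simp]: "compose_word f (a # w) x = f a (compose_word f w x)"
  by (simp_all add: compose_word_def)

lemma compose_word_append: "compose_word f (v @ w) x = compose_word f v (compose_word f w x)"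
  by (induction v) auto

text \<open>
  Equally contracting similarities whose images of the unit interval are ordered from left to right.
  Separation of the cells is expressed through the order because the order yields the distance between left
  endpoints by a direct induction on words.
\<close>
locale ordered_ifs =
  fixes N :: nat and r :: real and b :: "nat \<Rightarrow> real" and f :: "nat \<Rightarrow> real \<Rightarrow> real"
  assumes N_ge_2: "N \<ge> 2"
    and r_pos: "0 < r" and r_less_1: "r < 1"
    and affine: "\<And>i x. i \<in> {1..N} \<Longrightarrow> x \<in> {0..1} \<Longrightarrow> f i x = r * x + b i"
    and maps_to: "\<And>i. i \<in> {1..N} \<Longrightarrow> f i \<in> {0..1} \<rightarrow> {0..1}"
    and ordered: "\<And>i j x y. i \<in> {1..N} \<Longrightarrow> j \<in> {1..N} \<Longrightarrow> i < j \<Longrightarrow>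
           x \<in> f i ` {0..1} \<Longrightarrow> y \<in> f j ` {0..1} \<Longrightarrow> x \<le> y"
begin

abbreviation cell :: "nat list \<Rightarrow> real set" where
  "cell w \<equiv> compose_word f w ` {0..1}"

abbreviation left_end :: "nat list \<Rightarrow> real" where
  "left_end w \<equiv> compose_word f w 0"

lemma compose_word_in_unit:
  "w \<in> lists {1..N} \<Longrightarrow> x \<in> {0..1} \<Longrightarrow> compose_word f w x \<in> {0..1}"
proof (induction w)
  case (Cons a w)
  then show ?case using maps_to[of a] by (auto simp: Pi_iff)
qed auto

lemma compose_word_affine:
  "w \<in> lists {1..N} \<Longrightarrow> x \<in> {0..1} \<Longrightarrow> compose_word f w x = r ^ length w * x + left_end w"
proof (induction w)
  case (Cons a w)
  then have "compose_word f w x \<in> {0..1}" "left_end w \<in> {0..1}" "a \<in> {1..N}"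
    using compose_word_in_unit[of w x] compose_word_in_unit[of w 0] by auto
  then show ?case using Cons affine by (simp add: algebra_simps)
qed auto

lemma cell_eq:
  assumes "w \<in> lists {1..N}"
  shows "cell w = {left_end w .. left_end w + r ^ length w}"
proof -
  have "cell w = (\<lambda>x. r ^ length w * x + left_end w) ` {0..1}"
    by (intro image_cong refl compose_word_affine assms)
  then show ?thesis
    using r_pos unfolding image_affinity_atLeastAtMost by (simp add: add.commute)
qed

lemma cell_subset_unit: "w \<in> lists {1..N} \<Longrightarrow> cell w \<subseteq> {0..1}"
  using compose_word_in_unit by blast

lemma cell_append_subset: "w \<in> lists {1..N} \<Longrightarrow> cell (v @ w) \<subseteq> cell v"
  using compose_word_in_unit by (force simp: compose_word_append)

text \<open>
  At the first letter in which two words differ, the ordering of the two first-level images puts the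
  whole cell of one word to the left of the other cell; a common prefix scales both distances by the
  same power of \<open>r\<close>.
\<close>
lemma left_end_separated:
  assumes "v \<in> words N n" "w \<in> words N n" "v \<noteq> w"
  shows "r ^ n \<le> \<bar>left_end v - left_end w\<bar>"
  using assms
proof (induction n arbitrary: v w)
  case 0
  then show ?case by (simp add: words_def)
next
  case (Suc n)
  obtain i v' where v: "v = i # v'" "i \<in> {1..N}" "v' \<in> words N n"
    using Suc.prems(1) by (cases v) (auto simp: words_def)
  obtain j w' where w: "w = j # w'" "j \<in> {1..N}" "w' \<in> words N n"
    using Suc.prems(2) by (cases w) (auto simp: words_def)
  have unit: "left_end v' \<in> {0..1}" "left_end w' \<in> {0..1}"
    using compose_word_in_unit[of v' 0] compose_word_in_unit[of w' 0] v w by (auto simp: words_def)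
  have step: "left_end x + r ^ Suc n \<le> left_end y"
    if "x = i # x'" "y = j # y'" "i < j" "i \<in> {1..N}" "j \<in> {1..N}" "x' \<in> words N n" "y' \<in> words N n"
    for i j x y x' y'
  proof -
    have "{left_end x .. left_end x + r ^ Suc n} = cell x"
      using that cell_eq[of x] by (simp add: words_def)
    moreover have "left_end x \<le> left_end x + r ^ Suc n" using r_pos by simp
    ultimately have "left_end x + r ^ Suc n \<in> cell x" by auto
    then have "left_end x + r ^ Suc n \<in> f i ` {0..1}"
      using that cell_append_subset[of x' "[i]"] by (auto simp: words_def)
    moreover have "left_end y \<in> f j ` {0..1}"
      using that compose_word_in_unit[of y' 0] by (auto simp: words_def)
    ultimately show ?thesis using ordered that by blast
  qed
  consider "i = j" | "i < j" | "j < i" by linarith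
  then show ?case
  proof cases
    case 1
    then have "r ^ n \<le> \<bar>left_end v' - left_end w'\<bar>"
      using Suc v w by auto
    moreover have "left_end v - left_end w = r * (left_end v' - left_end w')"
      using 1 v w unit affine by (simp add: algebra_simps)
    ultimately show ?thesis using r_pos by (simp add: abs_mult)
  next
    case 2
    then show ?thesis using step[OF v(1) w(1)] v w by auto
  next
    case 3
    then show ?thesis using step[OF w(1) v(1)] v w by auto
  qed
qed

text \<open>
  Two cells that meet \<open>U\<close> have left endpoints at distance less than \<open>2 * r ^ n\<close>, whereas three separated
  left endpoints would span at least that length. This is what allows a covering set of diameter about
  \<open>r ^ n\<close> to be replaced by boundedly many words of length \<open>n\<close>.
\<close>
lemma card_cells_meeting_le_2:
  assumes "bounded U" "diameter U < r ^ n"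
  shows "card {w \<in> words N n. cell w \<inter> U \<noteq> {}} \<le> 2"
proof (rule ccontr)
  let ?S = "{w \<in> words N n. cell w \<inter> U \<noteq> {}}"
  assume "\<not> ?thesis"
  then have "3 \<le> card ?S" by simp
  then obtain T where T: "T \<subseteq> ?S" "card T = 3" by (rule obtain_subset_with_card_n)
  from T(2) obtain x y z where xyz: "T = {x, y, z}" "x \<noteq> y" "x \<noteq> z" "y \<noteq> z"
    by (auto simp: card_3_iff)
  have close: "\<bar>left_end v - left_end w\<bar> < 2 * r ^ n" if "v \<in> ?S" "w \<in> ?S" for v w
  proof -
    have vw: "v \<in> words N n" "w \<in> words N n" "cell v \<inter> U \<noteq> {}" "cell w \<inter> U \<noteq> {}"
      using that by simp_all
    then obtain p q where pq: "p \<in> cell v" "p \<in> U" "q \<in> cell w" "q \<in> U"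
      by (metis IntE all_not_in_conv)
    have "\<bar>p - q\<bar> \<le> diameter U"
      using diameter_bounded_bound[OF assms(1) pq(2,4)] by (simp add: dist_real_def)
    moreover have "p \<in> {left_end v .. left_end v + r ^ n}" "q \<in> {left_end w .. left_end w + r ^ n}"
      using pq(1,3) vw(1,2) cell_eq[of v] cell_eq[of w] unfolding words_def by simp_all
    ultimately show ?thesis using assms(2) unfolding atLeastAtMost_iff by linarith
  qed
  have S: "x \<in> ?S" "y \<in> ?S" "z \<in> ?S" using T(1) xyz(1) by simp_all
  then have W: "x \<in> words N n" "y \<in> words N n" "z \<in> words N n" by simp_all
  show False
    using close[OF S(1,2)] close[OF S(1,3)] close[OF S(2,3)]
      left_end_separated[OF W(1,2) xyz(2)] left_end_separated[OF W(1,3) xyz(3)]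
      left_end_separated[OF W(2,3) xyz(4)]
    by linarith
qed

lemma diameter_cell:
  assumes "w \<in> words N n"
  shows "bounded (cell w)" "diameter (cell w) = r ^ n"
proof -
  have "cell w = {left_end w .. left_end w + r ^ n}"
    using assms cell_eq[of w] unfolding words_def by blast
  then show "bounded (cell w)" "diameter (cell w) = r ^ n" using r_pos by simp_all
qed

lemma attractor_subset_cells:
  assumes "is_attractor N f C"
  shows "C \<subseteq> (\<Union>w\<in>words N n. cell w)"
proof -
  have "C \<subseteq> (\<Union>w\<in>words N n. compose_word f w ` C)"
  proof (induction n)
    case 0
    show ?case by (auto simp: words_def)
  next
    case (Suc n)
    show ?case
    proof
      fix x assume "x \<in> C"
      then obtain i y where i: "i \<in> {1..N}" "y \<in> C" "x = f i y"
        using assms unfolding is_attractor_def by blast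
      from subsetD[OF Suc i(2)] obtain w z
        where "w \<in> words N n" "z \<in> C" "y = compose_word f w z" by blast
      then have "i # w \<in> words N (Suc n)" "x = compose_word f (i # w) z"
        using i by (auto simp: words_def)
      then show "x \<in> (\<Union>w\<in>words N (Suc n). compose_word f w ` C)"
        using \<open>z \<in> C\<close> by blast
    qed
  qed
  moreover have "C \<subseteq> {0..1}" using assms by (simp add: is_attractor_def)
  then have "compose_word f w ` C \<subseteq> cell w" for w by (rule image_mono)
  ultimately show ?thesis by (meson UN_mono order_refl order_trans)
qed

lemma compose_word_attractor:
  assumes "is_attractor N f C" "w \<in> lists {1..N}" "x \<in> C"
  shows "compose_word f w x \<in> C"
  using assms(2)
proof (induction w)
  case (Cons a w)
  then have "a \<in> {1..N}" "compose_word f w x \<in> C" by auto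
  moreover have "C = (\<Union>i\<in>{1..N}. f i ` C)" using assms(1) unfolding is_attractor_def by simp
  ultimately show ?case by (metis UN_I compose_word_Cons imageI)
qed (use assms in simp)

text \<open>
  Every cell contains a point of the attractor, namely the image of any point of \<open>C\<close>; so a point that lies
  in cells of every level is a limit of points of the closed set \<open>C\<close>.
\<close>
lemma nested_cells_limit_in_attractor:
  assumes "is_attractor N f C" and "\<And>n. \<exists>w\<in>words N n. x \<in> cell w"
  shows "x \<in> C"
proof -
  have C: "closed C" "C \<noteq> {}" "C \<subseteq> {0..1}"
    using assms(1) compact_imp_closed unfolding is_attractor_def by auto
  then obtain c where c: "c \<in> C" by blast
  have "\<exists>y\<in>C. dist y x < e" if "0 < e" for e
  proof -
    obtain n where n: "r ^ n < e" using real_arch_pow_inv[OF \<open>0 < e\<close> r_less_1] by blast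
    obtain w where w: "w \<in> words N n" "x \<in> cell w" using assms(2) by blast
    have "compose_word f w c \<in> cell w" using c C(3) by (intro imageI) blast
    then have "dist (compose_word f w c) x \<le> r ^ n"
      using w cell_eq[of w] by (auto simp: words_def dist_real_def)
    moreover have "compose_word f w c \<in> C"
      using compose_word_attractor[OF assms(1) _ c] w by (auto simp: words_def)
    ultimately show ?thesis using n by force
  qed
  then have "x \<in> closure C" by (simp add: closure_approachable)
  then show ?thesis using C by simp
qed

lemma upper_box_dim_subset_attractor:
  assumes "is_attractor N f C" "A \<subseteq> C" "A \<noteq> {}"
  shows "upper_box_dim A \<le> ereal (- (ln (real N) / ln r))"
proof (rule upper_box_dim_le_geometric_covers)
  show "bounded A" using assms bounded_subset[of "{0..1::real}" A] by (auto simp: is_attractor_def)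
  fix n
  have "card (cell ` words N n) \<le> N ^ n"
    using card_image_le[of "words N n" cell] by simp
  moreover have "A \<subseteq> \<Union>(cell ` words N n)"
    using attractor_subset_cells[OF assms(1)] assms(2) by blast
  moreover have "\<forall>U\<in>cell ` words N n. bounded U \<and> diameter U \<le> r ^ n"
    using diameter_cell by auto
  ultimately show "\<exists>\<U>. finite \<U> \<and> card \<U> \<le> N ^ n \<and> A \<subseteq> \<Union>\<U> \<and>
      (\<forall>U\<in>\<U>. bounded U \<and> diameter U \<le> r ^ n)"
    by (intro exI[of _ "cell ` words N n"]) auto
qed (use assms N_ge_2 r_pos r_less_1 in auto)

end

section \<open>Independent uniform labels on the tree\<close>

lemma prob_space_uniform_point_measure:
  assumes "1 \<le> N" and "\<And>i. i \<in> {1..N} \<Longrightarrow> p i = 1 / real N"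
  shows "prob_space (point_measure {1..N} (\<lambda>i. ennreal (p i)))"
proof
  have "(\<Sum>i\<in>{1..N}. ennreal (p i)) = (\<Sum>i\<in>{1..N}. ennreal (1 / real N))"
    using assms(2) by (intro sum.cong) auto
  also have "\<dots> = 1"
    using assms(1) by (simp add: ennreal_of_nat_eq_real_of_nat ennreal_mult[symmetric])
  finally show "emeasure (point_measure {1..N} (\<lambda>i. ennreal (p i)))
      (space (point_measure {1..N} (\<lambda>i. ennreal (p i)))) = 1"
    by (simp add: emeasure_point_measure_finite space_point_measure)
qed

lemma space_label_measure: "space (label_measure N p) = {1..} \<rightarrow>\<^sub>E {1..N}"
  by (simp add: label_measure_def space_PiM space_point_measure)

context
  fixes N :: nat and p :: "nat \<Rightarrow> real"
  assumes N_pos: "1 \<le> N" and unif: "\<And>i. i \<in> {1..N} \<Longrightarrow> p i = 1 / real N"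
begin

lemma prob_space_label_measure: "prob_space (label_measure N p)"
  unfolding label_measure_def
  by (intro prob_space_PiM prob_space_uniform_point_measure N_pos unif)

text \<open>
  The coordinates are addressed through an injection \<open>h\<close> because the labels are indexed by tree nodes,
  which enter the sequence \<open>\<omega>\<close> through their position \<^const>\<open>kappa\<close>; the ray measure below uses the identity.
\<close>
lemma cylinder:
  assumes E: "finite E" "inj_on h E" "h ` E \<subseteq> {1..}" and g: "\<And>e. e \<in> E \<Longrightarrow> g e \<in> {1..N}"
  shows cylinder_sets: "{\<omega> \<in> space (label_measure N p). \<forall>e\<in>E. \<omega> (h e) = g e} \<in> sets (label_measure N p)"
    and emeasure_cylinder: "emeasure (label_measure N p) {\<omega> \<in> space (label_measure N p). \<forall>e\<in>E. \<omega> (h e) = g e}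
           = ennreal ((1 / real N) ^ card E)"
proof -
  let ?M = "\<lambda>_::nat. point_measure {1..N} (\<lambda>i. ennreal (p i))"
  let ?X = "\<lambda>k. {g (the_inv_into E h k)}"
  interpret prob_space "?M k" for k
    by (rule prob_space_uniform_point_measure[OF N_pos unif])
  interpret product_prob_space ?M "{1..}" by unfold_locales
  have eq: "{\<omega> \<in> space (label_measure N p). \<forall>e\<in>E. \<omega> (h e) = g e}
      = {\<omega> \<in> space (Pi\<^sub>M {1..} ?M). \<forall>k\<in>h ` E. \<omega> k \<in> ?X k}"
    using E(2) by (auto simp: label_measure_def the_inv_into_f_f)
  have X: "?X k \<in> sets (?M k)" if "k \<in> h ` E" for k
    using that g E(2) by (auto simp: sets_point_measure the_inv_into_f_f)
  show "{\<omega> \<in> space (label_measure N p). \<forall>e\<in>E. \<omega> (h e) = g e} \<in> sets (label_measure N p)"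
  proof (cases "E = {}")
    case False
    have "{\<omega> \<in> space (Pi\<^sub>M {1..} ?M). \<forall>k\<in>h ` E. \<omega> k \<in> ?X k} = 
        (\<Inter>k\<in>h ` E. (\<lambda>\<omega>. \<omega> k) -` ?X k \<inter> space (Pi\<^sub>M {1..} ?M))"
      using False by auto
    moreover have "\<dots> \<in> sets (Pi\<^sub>M {1..} ?M)"
      using False E(1,3) X by (intro sets.finite_INT measurable_sets[OF measurable_component_singleton]) auto
    ultimately show ?thesis unfolding eq by (simp add: label_measure_def)
  qed simp
  have "emeasure (Pi\<^sub>M {1..} ?M) {\<omega> \<in> space (Pi\<^sub>M {1..} ?M). \<forall>k\<in>h ` E. \<omega> k \<in> ?X k}
      = (\<Prod>k\<in>h ` E. emeasure (?M k) (?X k))"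
    using E X by (intro emeasure_PiM_Collect) auto
  also have "\<dots> = (\<Prod>e\<in>E. emeasure (?M (h e)) {g e})"
    using E(2) by (simp add: prod.reindex the_inv_into_f_f)
  also have "\<dots> = (\<Prod>e\<in>E. ennreal (1 / real N))"
    using g unif by (intro prod.cong) (auto simp: emeasure_point_measure_finite)
  finally show "emeasure (label_measure N p) {\<omega> \<in> space (label_measure N p). \<forall>e\<in>E. \<omega> (h e) = g e}
           = ennreal ((1 / real N) ^ card E)"
    unfolding eq by (simp add: label_measure_def ennreal_power)
qed

end

text \<open>
  The order by length and then lexicographically is a strict linear order with finite initial segments on
  words over a finite alphabet. Hence \<^const>\<open>kappa\<close>, which counts predecessors, is injective, and distinct
  edges of the tree carry independent labels.
\<close>
lemma finite_kappa_set:
  "finite {v \<in> lists {1..M}. (v, w) \<in> lenlex less_than}"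
proof (rule finite_subset)
  show "{v \<in> lists {1..M}. (v, w) \<in> lenlex less_than} \<subseteq> {v. set v \<subseteq> {1..M} \<and> length v \<le> length w}"
    by (auto dest: lenlex_length)
  show "finite {v. set v \<subseteq> {1..M} \<and> length v \<le> length w}"
    by (rule finite_lists_length_le) simp
qed

lemma kappa_strict_mono:
  assumes "v \<in> lists {1..M}" "(v, w) \<in> lenlex less_than"
  shows "kappa M v < kappa M w"
  unfolding kappa_def
proof (intro psubset_card_mono finite_kappa_set psubsetI)
  show "{x \<in> lists {1..M}. (x, v) \<in> lenlex less_than} \<subseteq> {x \<in> lists {1..M}. (x, w) \<in> lenlex less_than}"
    using assms(2) lenlex_trans[OF _ _ trans_less_than] by blast
  have "(v, v) \<notin> lenlex less_than" by (rule lenlex_irreflexive) simp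
  then show "{x \<in> lists {1..M}. (x, v) \<in> lenlex less_than} \<noteq> {x \<in> lists {1..M}. (x, w) \<in> lenlex less_than}"
    using assms by blast
qed

lemma inj_on_kappa: "inj_on (kappa M) (lists {1..M})"
proof (rule inj_onI)
  fix v w assume vw: "v \<in> lists {1..M}" "w \<in> lists {1..M}" "kappa M v = kappa M w"
  show "v = w"
  proof (rule ccontr)
    assume "v \<noteq> w"
    then have "(v, w) \<in> lenlex less_than \<or> (w, v) \<in> lenlex less_than"
      using total_lenlex[OF total_less_than] by (auto simp: total_on_def)
    then show False using kappa_strict_mono vw by (metis less_irrefl)
  qed
qed

lemma kappa_pos: "w \<noteq> [] \<Longrightarrow> 1 \<le> kappa M w"
  using kappa_strict_mono[of "[]" M w] by simp

text \<open>
  The word of labels read along the path from the root to the node \<open>u\<close>.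
\<close>
definition label_word :: "nat \<Rightarrow> (nat \<Rightarrow> nat) \<Rightarrow> nat list \<Rightarrow> nat list" where
  "label_word M \<omega> u = map (\<lambda>k. edge_label M \<omega> (take k u)) [1..<Suc (length u)]"

lemma length_label_word [simp]: "length (label_word M \<omega> u) = length u"
  by (simp add: label_word_def del: upt_Suc)

lemma nth_label_word: "k < length u \<Longrightarrow> label_word M \<omega> u ! k = \<omega> (kappa M (take (Suc k) u))"
  by (simp add: label_word_def edge_label_def del: upt_Suc)

lemma label_word_in_words:
  assumes "\<omega> \<in> {1..} \<rightarrow> {1..N}" "u \<in> words M n"
  shows "label_word M \<omega> u \<in> words N n"
proof -
  have "label_word M \<omega> u ! k \<in> {1..N}" if "k < length u" for k
  proof -
    have "take (Suc k) u \<noteq> []" using that by auto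
    then have "kappa M (take (Suc k) u) \<in> {1..}" using kappa_pos by simp
    then show ?thesis using assms(1) nth_label_word[OF that] by (metis Pi_mem)
  qed
  then show ?thesis
    using assms(2) by (auto simp: words_eq in_set_conv_nth)
qed

lemma word_prefix_in_words: "\<sigma> \<in> {1..} \<rightarrow> {1..M} \<Longrightarrow> word_prefix \<sigma> n \<in> words M n"
  by (auto simp: word_prefix_def words_eq Pi_iff simp del: upt_Suc)

lemma take_word_prefix: "k \<le> n \<Longrightarrow> take k (word_prefix \<sigma> n) = word_prefix \<sigma> k"
  by (simp add: word_prefix_def take_map take_upt del: upt_Suc)

lemma length_word_prefix [simp]: "length (word_prefix \<sigma> n) = n"
  by (simp add: word_prefix_def)

lemma label_word_word_prefix:
  "label_word M \<omega> (word_prefix \<sigma> n) = map (\<lambda>k. edge_label M \<omega> (word_prefix \<sigma> k)) [1..<Suc n]"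
  by (simp add: label_word_def take_word_prefix del: upt_Suc)

lemma random_set_eq:
  "random_set M f \<omega> = {x. \<exists>\<sigma>\<in>{1..} \<rightarrow> {1..M}.
     {x} = (\<Inter>n\<in>{1..}. compose_word f (label_word M \<omega> (word_prefix \<sigma> n)) ` {0..1})}"
  by (simp only: random_set_def label_word_word_prefix)

section \<open>Counting pairs of nodes with equal label words\<close>

text \<open>
  The number of nodes whose path carries the label word \<open>w\<close>; divided by \<open>M\<close> to the length of \<open>w\<close> it is the mass of
  the rays that read \<open>w\<close>.
\<close>
definition label_count :: "nat \<Rightarrow> (nat \<Rightarrow> nat) \<Rightarrow> nat list \<Rightarrow> nat" where
  "label_count M \<omega> w = card {v \<in> words M (length w). label_word M \<omega> v = w}"

text \<open>
  The number of ordered pairs of nodes of level \<open>n\<close> with equal label words: divided by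
  \<open>M ^ (2 * n)\<close>, the sum over the label words of length \<open>n\<close> of the squared masses of the rays that read them.
\<close>
definition collisions :: "nat \<Rightarrow> (nat \<Rightarrow> nat) \<Rightarrow> nat \<Rightarrow> nat" where
  "collisions M \<omega> n = (\<Sum>u\<in>words M n. label_count M \<omega> (label_word M \<omega> u))"

definition prefixes_upto :: "nat \<Rightarrow> nat list \<Rightarrow> nat list set" where
  "prefixes_upto n u = (\<lambda>k. take k u) ` {1..n}"

lemma label_word_eq_iff:
  assumes "u \<in> words M n" "w \<in> words N n"
  shows "label_word M \<omega> u = w \<longleftrightarrow> (\<forall>e\<in>prefixes_upto n u. \<omega> (kappa M e) = w ! (length e - 1))"
proof -
  have len: "length u = n" "length w = n" using assms by (auto simp: words_def)
  have "label_word M \<omega> u = w \<longleftrightarrow> (\<forall>k<n. \<omega> (kappa M (take (Suc k) u)) = w ! k)"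
    using len by (auto simp: list_eq_iff_nth_eq nth_label_word)
  also have "\<dots> \<longleftrightarrow> (\<forall>j\<in>{1..n}. \<omega> (kappa M (take j u)) = w ! (j - 1))"
    unfolding image_Suc_lessThan[symmetric] by auto
  also have "\<dots> \<longleftrightarrow> (\<forall>e\<in>prefixes_upto n u. \<omega> (kappa M e) = w ! (length e - 1))"
    using len by (simp add: prefixes_upto_def min_absorb2)
  finally show ?thesis .
qed

text \<open>
  All prefixes of \<open>u\<close> are distinct from the prefixes of \<open>v\<close> that are longer than \<open>m\<close>.
\<close>
lemma card_prefixes_union_ge:
  assumes "length u = n" "length v = n" "m \<le> n"
    and "\<And>k. m < k \<Longrightarrow> k \<le> n \<Longrightarrow> take k u \<noteq> take k v"
  shows "n + (n - m) \<le> card (prefixes_upto n u \<union> prefixes_upto n v)"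
proof -
  let ?A = "(\<lambda>k. take k u) ` {1..n}" and ?B = "(\<lambda>k. take k v) ` {m<..n}"
  have "inj_on (\<lambda>k. take k u) {1..n}" "inj_on (\<lambda>k. take k v) {m<..n}"
    using assms(1,2) by (auto intro!: inj_on_inverseI[where g = length])
  then have "card ?A = n" "card ?B = n - m" by (simp_all add: card_image)
  moreover have "?A \<inter> ?B = {}"
  proof -
    have False if "j \<in> {1..n}" "k \<in> {m<..n}" "take j u = take k v" for j k
    proof -
      have "j = k" using arg_cong[OF that(3), of length] that(1,2) assms(1,2) by simp
      then show False using that assms(4)[of k] by simp
    qed
    then show ?thesis by blast
  qed
  ultimately have "card (?A \<union> ?B) = n + (n - m)" by (subst card_Un_disjoint) auto
  moreover have "card (?A \<union> ?B) \<le> card (prefixes_upto n u \<union> prefixes_upto n v)"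
    unfolding prefixes_upto_def by (intro card_mono) auto
  ultimately show ?thesis by simp
qed

context
  fixes N M :: nat and p :: "nat \<Rightarrow> real"
  assumes N_pos: "1 \<le> N" and unif: "\<And>i. i \<in> {1..N} \<Longrightarrow> p i = 1 / real N"
begin

text \<open>
  Fix a common value \<open>w\<close> of the two label words. It prescribes the label of every edge that lies on one of
  the two paths, by depth. If the paths separate after level \<open>m\<close>, these are at least \<open>n + (n - m)\<close> edges, so the
  event has probability at most \<open>(1/N) ^ (n + (n - m))\<close>, and there are \<open>N ^ n\<close> candidates for \<open>w\<close>.
\<close>
lemma labels_agree:
  assumes u: "u \<in> words M n" and v: "v \<in> words M n"
  shows labels_agree_sets:
      "{\<omega> \<in> space (label_measure N p). label_word M \<omega> u = label_word M \<omega> v} \<in> sets (label_measure N p)"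
    and emeasure_labels_agree:
      "m \<le> n \<Longrightarrow> (\<And>k. m < k \<Longrightarrow> k \<le> n \<Longrightarrow> take k u \<noteq> take k v) \<Longrightarrow>
       emeasure (label_measure N p) {\<omega> \<in> space (label_measure N p). label_word M \<omega> u = label_word M \<omega> v}
         \<le> ennreal ((1 / real N) ^ (n - m))"
proof -
  let ?P = "label_measure N p"
  define E where "E = prefixes_upto n u \<union> prefixes_upto n v"
  define Z where "Z w = {\<omega> \<in> space ?P. \<forall>e\<in>E. \<omega> (kappa M e) = w ! (length e - 1)}" for w
  have E: "finite E" "\<And>e. e \<in> E \<Longrightarrow> e \<in> lists {1..M} \<and> e \<noteq> [] \<and> length e - 1 < n"
    using u v by (auto simp: E_def prefixes_upto_def words_def dest!: in_set_takeD)
  have inj: "inj_on (kappa M) E" using inj_on_subset[OF inj_on_kappa] E(2) by blast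
  have pos: "kappa M ` E \<subseteq> {1..}" using E(2) kappa_pos by auto
  have g: "w ! (length e - 1) \<in> {1..N}" if "w \<in> words N n" "e \<in> E" for w e
    using that E(2)[of e] nth_mem[of "length e - 1" w] unfolding words_eq by blast
  have Z: "Z w \<in> sets ?P" "emeasure ?P (Z w) = ennreal ((1 / real N) ^ card E)" if "w \<in> words N n" for w
    unfolding Z_def
    using cylinder_sets[OF N_pos unif E(1) inj pos g[OF that]]
      emeasure_cylinder[OF N_pos unif E(1) inj pos g[OF that]] by auto
  have eq: "{\<omega> \<in> space ?P. label_word M \<omega> u = label_word M \<omega> v} = (\<Union>w\<in>words N n. Z w)"
  proof -
    have "label_word M \<omega> u = label_word M \<omega> v \<longleftrightarrow> (\<exists>w\<in>words N n. \<forall>e\<in>E. \<omega> (kappa M e) = w ! (length e - 1))"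
      if "\<omega> \<in> space ?P" for \<omega>
    proof -
      have "\<omega> \<in> {1..} \<rightarrow> {1..N}" using that by (auto simp: space_label_measure PiE_def)
      then have "label_word M \<omega> u \<in> words N n" by (rule label_word_in_words[OF _ u])
      then have "label_word M \<omega> u = label_word M \<omega> v \<longleftrightarrow>
          (\<exists>w\<in>words N n. label_word M \<omega> u = w \<and> label_word M \<omega> v = w)" by metis
      also have "\<dots> \<longleftrightarrow> (\<exists>w\<in>words N n. \<forall>e\<in>E. \<omega> (kappa M e) = w ! (length e - 1))"
        using label_word_eq_iff[OF u] label_word_eq_iff[OF v] unfolding E_def
        by (intro bex_cong refl) (simp add: ball_Un)
      finally show ?thesis .
    qed
    then show ?thesis unfolding Z_def by blast
  qed
  show "{\<omega> \<in> space ?P. label_word M \<omega> u = label_word M \<omega> v} \<in> sets ?P"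
    unfolding eq using Z(1) by (intro sets.finite_UN) auto
  assume m: "m \<le> n" "\<And>k. m < k \<Longrightarrow> k \<le> n \<Longrightarrow> take k u \<noteq> take k v"
  have cE: "n + (n - m) \<le> card E"
    unfolding E_def using u v m by (intro card_prefixes_union_ge) (auto simp: words_def)
  have "emeasure ?P (\<Union>w\<in>words N n. Z w) \<le> (\<Sum>w\<in>words N n. emeasure ?P (Z w))"
    using Z(1) by (intro emeasure_subadditive_finite) auto
  also have "\<dots> = ennreal (real N ^ n * (1 / real N) ^ card E)"
    by (simp add: Z(2) ennreal_mult ennreal_power[symmetric] ennreal_of_nat_eq_real_of_nat)
  also have "\<dots> \<le> ennreal (real N ^ n * (1 / real N) ^ (n + (n - m)))"
    using N_pos cE by (intro ennreal_leI mult_left_mono power_decreasing) auto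
  also have "real N ^ n * (1 / real N) ^ (n + (n - m)) = (1 / real N) ^ (n - m)"
    using N_pos by (simp add: power_add power_divide)
  finally show "emeasure ?P {\<omega> \<in> space ?P. label_word M \<omega> u = label_word M \<omega> v} \<le> ennreal ((1 / real N) ^ (n - m))"
    unfolding eq .
qed

text \<open>
  The estimate for the longest common prefix is enlarged to a sum over all common prefixes, so that pairs of
  words can later be counted one level at a time.
\<close>
lemma emeasure_labels_agree_le_sum:
  assumes u: "u \<in> words M n" and v: "v \<in> words M n"
  shows "emeasure (label_measure N p) {\<omega> \<in> space (label_measure N p). label_word M \<omega> u = label_word M \<omega> v}
         \<le> ennreal (\<Sum>m\<le>n. if take m u = take m v then (1 / real N) ^ (n - m) else 0)"
proof -
  define m where "m = Max {k. k \<le> n \<and> take k u = take k v}"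
  have "m \<in> {k. k \<le> n \<and> take k u = take k v}"
    unfolding m_def by (intro Max_in) (auto intro: exI[of _ 0])
  then have m: "m \<le> n" "take m u = take m v" by auto
  have "finite {k. k \<le> n \<and> take k u = take k v}" by simp
  from Max_ge[OF this] have "take k u \<noteq> take k v" if "m < k" "k \<le> n" for k
    using that unfolding m_def by (metis (mono_tags, lifting) mem_Collect_eq not_le)
  then have "emeasure (label_measure N p) {\<omega> \<in> space (label_measure N p). label_word M \<omega> u = label_word M \<omega> v}
         \<le> ennreal ((1 / real N) ^ (n - m))"
    using emeasure_labels_agree[OF u v m(1)] by blast
  also have "(1 / real N) ^ (n - m) = (if take m u = take m v then (1 / real N) ^ (n - m) else 0)"
    using m by simp
  also have "\<dots> \<le> (\<Sum>m\<le>n. if take m u = take m v then (1 / real N) ^ (n - m) else 0)"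
    using m(1) by (intro member_le_sum) auto
  finally show ?thesis by (simp add: ennreal_leI)
qed

lemma card_words_common_prefix_le:
  assumes "u \<in> words M n" "m \<le> n"
  shows "card {v \<in> words M n. take m u = take m v} \<le> M ^ (n - m)"
proof -
  have "inj_on (drop m) {v \<in> words M n. take m u = take m v}"
    by (rule inj_onI) (metis (mono_tags, lifting) append_take_drop_id mem_Collect_eq)
  moreover have "drop m ` {v \<in> words M n. take m u = take m v} \<subseteq> words M (n - m)"
    by (auto simp: words_eq dest: in_set_dropD)
  ultimately have "card {v \<in> words M n. take m u = take m v} \<le> card (words M (n - m))"
    by (intro card_inj_on_le) auto
  then show ?thesis by simp
qed

text \<open>
  There are at most \<open>M ^ n * M ^ (n - m)\<close> pairs of words with common prefix of length \<open>m\<close>, each weighted by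
  \<open>(1/N) ^ (n - m)\<close>. Here \<open>N \<le> M\<close> is decisive: it makes every level contribute at most
  \<open>(M\<^sup>2/N) ^ n\<close>, so that the expectation exceeds the ideal value by a factor \<open>n + 1\<close> only, even in
  the critical case \<open>M = N\<close> in which the branching process of any fixed label sequence dies out.
\<close>
lemma borel_measurable_collisions:
  "(\<lambda>\<omega>. real (collisions M \<omega> n)) \<in> borel_measurable (label_measure N p)"
  and expected_collisions_le:
  "N \<le> M \<Longrightarrow> (\<integral>\<^sup>+\<omega>. ennreal (real (collisions M \<omega> n)) \<partial>label_measure N p)
     \<le> ennreal (real (n + 1) * (real M ^ 2 / real N) ^ n)"
proof -
  let ?P = "label_measure N p"
  define A where "A u v = {\<omega> \<in> space ?P. label_word M \<omega> u = label_word M \<omega> v}" for u v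
  have A: "A u v \<in> sets ?P" if "u \<in> words M n" "v \<in> words M n" for u v
    unfolding A_def using labels_agree_sets[OF that] .
  have eq: "real (collisions M \<omega> n) = (\<Sum>u\<in>words M n. \<Sum>v\<in>words M n. indicat_real (A u v) \<omega>)"
    if "\<omega> \<in> space ?P" for \<omega>
  proof -
    have "real (label_count M \<omega> (label_word M \<omega> u)) = (\<Sum>v\<in>words M n. indicat_real (A u v) \<omega>)"
      if "u \<in> words M n" for u
    proof -
      have "(\<Sum>v\<in>words M n. indicat_real (A u v) \<omega>) = (\<Sum>v\<in>words M n. if label_word M \<omega> v = label_word M \<omega> u then 1 else 0)"
        using \<open>\<omega> \<in> space ?P\<close> by (intro sum.cong) (auto simp: A_def)
      also have "\<dots> = real (card {v \<in> words M n. label_word M \<omega> v = label_word M \<omega> u})"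
        by (simp add: sum.If_cases Int_def)
      finally show ?thesis using that by (simp add: label_count_def words_def)
    qed
    then show ?thesis by (simp add: collisions_def)
  qed
  have "(\<lambda>\<omega>. \<Sum>u\<in>words M n. \<Sum>v\<in>words M n. indicat_real (A u v) \<omega>) \<in> borel_measurable ?P"
    using A by (intro borel_measurable_sum borel_measurable_indicator) auto
  then show "(\<lambda>\<omega>. real (collisions M \<omega> n)) \<in> borel_measurable ?P"
    by (subst measurable_cong[OF eq])
  assume "N \<le> M"
  let ?c = "\<lambda>u v m. if take m u = take m v then (1 / real N) ^ (n - m) else 0"
  have "(\<integral>\<^sup>+\<omega>. ennreal (real (collisions M \<omega> n)) \<partial>?P)
      = (\<integral>\<^sup>+\<omega>. (\<Sum>u\<in>words M n. \<Sum>v\<in>words M n. indicator (A u v) \<omega>) \<partial>?P)"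
  proof (rule nn_integral_cong)
    fix \<omega> assume "\<omega> \<in> space ?P"
    then show "ennreal (real (collisions M \<omega> n)) = (\<Sum>u\<in>words M n. \<Sum>v\<in>words M n. indicator (A u v) \<omega>)"
      unfolding eq[OF \<open>\<omega> \<in> space ?P\<close>]
      by (simp add: sum_ennreal[symmetric] sum_nonneg ennreal_indicator del: sum_ennreal)
  qed
  also have "\<dots> = (\<Sum>u\<in>words M n. \<Sum>v\<in>words M n. emeasure ?P (A u v))"
    using A by (simp add: nn_integral_sum)
  also have "\<dots> \<le> (\<Sum>u\<in>words M n. \<Sum>v\<in>words M n. ennreal (\<Sum>m\<le>n. ?c u v m))"
    unfolding A_def by (intro sum_mono emeasure_labels_agree_le_sum)
  also have "\<dots> = ennreal (\<Sum>u\<in>words M n. \<Sum>v\<in>words M n. \<Sum>m\<le>n. ?c u v m)"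
    by (simp add: sum_nonneg)
  also have "\<dots> \<le> ennreal (real (n + 1) * (real M ^ 2 / real N) ^ n)"
  proof (rule ennreal_leI)
    have "(\<Sum>v\<in>words M n. \<Sum>m\<le>n. ?c u v m) \<le> real (n + 1) * (real M / real N) ^ n" if "u \<in> words M n" for u
    proof -
      have "(\<Sum>v\<in>words M n. \<Sum>m\<le>n. ?c u v m) = (\<Sum>m\<le>n. \<Sum>v\<in>words M n. ?c u v m)"
        by (rule sum.swap)
      also have "\<dots> \<le> (\<Sum>m\<le>n. (real M / real N) ^ n)"
      proof (rule sum_mono)
        fix m assume m: "m \<in> {..n}"
        have "(\<Sum>v\<in>words M n. ?c u v m) = real (card {v \<in> words M n. take m u = take m v}) * (1 / real N) ^ (n - m)"
          by (simp add: sum.If_cases Int_def)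
        also have "\<dots> \<le> real (M ^ (n - m)) * (1 / real N) ^ (n - m)"
          using card_words_common_prefix_le[OF that] m
          by (intro mult_right_mono of_nat_mono) auto
        also have "\<dots> = (real M / real N) ^ (n - m)"
          by (simp add: power_mult_distrib[symmetric])
        also have "\<dots> \<le> (real M / real N) ^ n"
          using \<open>N \<le> M\<close> N_pos by (intro power_increasing) auto
        finally show "(\<Sum>v\<in>words M n. ?c u v m) \<le> (real M / real N) ^ n" .
      qed
      finally show ?thesis by simp
    qed
    then have "(\<Sum>u\<in>words M n. \<Sum>v\<in>words M n. \<Sum>m\<le>n. ?c u v m)
        \<le> (\<Sum>u\<in>words M n. real (n + 1) * (real M / real N) ^ n)"
      by (rule sum_mono)
    also have "\<dots> = real (n + 1) * (real M ^ 2 / real N) ^ n"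
      by (simp add: power2_eq_square power_mult_distrib power_divide)
    finally show "(\<Sum>u\<in>words M n. \<Sum>v\<in>words M n. \<Sum>m\<le>n. ?c u v m) \<le> real (n + 1) * (real M ^ 2 / real N) ^ n" .
  qed
  finally show "(\<integral>\<^sup>+\<omega>. ennreal (real (collisions M \<omega> n)) \<partial>?P) \<le> ennreal (real (n + 1) * (real M ^ 2 / real N) ^ n)" .
qed

text \<open>
  The extra factor \<open>(n + 1)\<^sup>2\<close> over the expected value makes the sum over \<open>n\<close> of the normalized
  expectations converge, so the sum of the normalized counts is almost surely finite and bounds each term.
\<close>
lemma AE_collisions_bounded:
  assumes "N \<le> M"
  shows "AE \<omega> in label_measure N p. \<exists>K. \<forall>n.
     real (collisions M \<omega> n) \<le> K * (real (n + 1) ^ 3 * (real M ^ 2 / real N) ^ n)"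
proof -
  let ?P = "label_measure N p"
  define c where "c n = real (n + 1) ^ 3 * (real M ^ 2 / real N) ^ n" for n
  have c_pos: "0 < c n" for n using N_pos assms by (simp add: c_def)
  let ?g = "\<lambda>n \<omega>. ennreal (real (collisions M \<omega> n) / c n)"
  have meas: "?g n \<in> borel_measurable ?P" for n
    using borel_measurable_collisions by measurable
  have int: "(\<integral>\<^sup>+\<omega>. ?g n \<omega> \<partial>?P) \<le> ennreal (1 / real (n + 1) ^ 2)" for n
  proof -
    have "(\<integral>\<^sup>+\<omega>. ?g n \<omega> \<partial>?P) = (\<integral>\<^sup>+\<omega>. ennreal (1 / c n) * ennreal (real (collisions M \<omega> n)) \<partial>?P)"
      using c_pos[of n] by (intro nn_integral_cong) (simp add: ennreal_mult[symmetric])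
    also have "\<dots> = ennreal (1 / c n) * (\<integral>\<^sup>+\<omega>. ennreal (real (collisions M \<omega> n)) \<partial>?P)"
      using borel_measurable_collisions by (intro nn_integral_cmult) auto
    also have "\<dots> \<le> ennreal (1 / c n) * ennreal (real (n + 1) * (real M ^ 2 / real N) ^ n)"
      by (intro mult_left_mono expected_collisions_le assms) auto
    also have "\<dots> = ennreal (1 / c n * (real (n + 1) * (real M ^ 2 / real N) ^ n))"
      using c_pos[of n] by (intro ennreal_mult[symmetric]) auto
    also have "1 / c n * (real (n + 1) * (real M ^ 2 / real N) ^ n) = 1 / real (n + 1) ^ 2"
      using N_pos assms by (simp add: c_def power3_eq_cube power2_eq_square)
    finally show ?thesis .
  qed
  have "summable (\<lambda>n. 1 / real (n + 1) ^ 2)"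
    using summable_Suc_iff[of "\<lambda>n. inverse (real n ^ 2)"] inverse_power_summable[of 2, where 'a = real]
    by (simp add: inverse_eq_divide)
  then have fin: "(\<Sum>n. ennreal (1 / real (n + 1) ^ 2)) \<noteq> \<infinity>"
    by (subst suminf_ennreal2) auto
  have "(\<integral>\<^sup>+\<omega>. (\<Sum>n. ?g n \<omega>) \<partial>?P) = (\<Sum>n. \<integral>\<^sup>+\<omega>. ?g n \<omega> \<partial>?P)"
    using meas by (rule nn_integral_suminf)
  also have "\<dots> \<le> (\<Sum>n. ennreal (1 / real (n + 1) ^ 2))"
    using int by (intro suminf_le) auto
  finally have "(\<integral>\<^sup>+\<omega>. (\<Sum>n. ?g n \<omega>) \<partial>?P) \<noteq> \<infinity>"
    using fin by (metis infinity_ennreal_def neq_top_trans)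
  then have "AE \<omega> in ?P. (\<Sum>n. ?g n \<omega>) \<noteq> \<infinity>"
    using meas by (intro nn_integral_PInf_AE borel_measurable_suminf) auto
  then show ?thesis
  proof (rule AE_mp, intro AE_I2 impI)
    fix \<omega> assume "(\<Sum>n. ?g n \<omega>) \<noteq> \<infinity>"
    then obtain K where K: "0 \<le> K" "(\<Sum>n. ?g n \<omega>) = ennreal K"
      by (cases "\<Sum>n. ?g n \<omega>" rule: ennreal_cases) auto
    have "real (collisions M \<omega> n) \<le> K * c n" for n
    proof -
      have "?g n \<omega> \<le> (\<Sum>n. ?g n \<omega>)"
        using sum_le_suminf[of "\<lambda>n. ?g n \<omega>" "{n}"] by auto
      then have "real (collisions M \<omega> n) / c n \<le> K" using K by simp
      then show ?thesis using c_pos[of n] by (simp add: field_simps)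
    qed
    then show "\<exists>K. \<forall>n. real (collisions M \<omega> n) \<le> K * (real (n + 1) ^ 3 * (real M ^ 2 / real N) ^ n)"
      unfolding c_def by blast
  qed
qed

end

section \<open>Mass distribution along random rays\<close>

context
  fixes M :: nat
  assumes M_pos: "1 \<le> M"
begin

abbreviation ray_measure :: "(nat \<Rightarrow> nat) measure" where
  "ray_measure \<equiv> label_measure M (\<lambda>_. 1 / real M)"

lemma prefix_event:
  assumes "S \<subseteq> words M n"
  shows prefix_event_sets: "{\<sigma> \<in> space ray_measure. word_prefix \<sigma> n \<in> S} \<in> sets ray_measure"
    and emeasure_prefix_event:
      "emeasure ray_measure {\<sigma> \<in> space ray_measure. word_prefix \<sigma> n \<in> S} \<le> ennreal (real (card S) / real M ^ n)"
proof -
  define Z where "Z u = {\<sigma> \<in> space ray_measure. \<forall>k\<in>{1..n}. \<sigma> (id k) = u ! (k - 1)}" for u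
  have Z: "Z u \<in> sets ray_measure" "emeasure ray_measure (Z u) = ennreal ((1 / real M) ^ n)"
    if "u \<in> words M n" for u
  proof -
    have "u ! (k - 1) \<in> {1..M}" if "k \<in> {1..n}" for k
    proof -
      have "u ! (k - 1) \<in> set u" using \<open>u \<in> words M n\<close> that by (auto simp: words_def)
      then show ?thesis using \<open>u \<in> words M n\<close> unfolding words_eq by blast
    qed
    from cylinder_sets[OF M_pos refl, of "{1..n}" id "\<lambda>k. u ! (k - 1)", OF _ _ _ this]
      emeasure_cylinder[OF M_pos refl, of "{1..n}" id "\<lambda>k. u ! (k - 1)", OF _ _ _ this]
    show "Z u \<in> sets ray_measure" "emeasure ray_measure (Z u) = ennreal ((1 / real M) ^ n)"
      unfolding Z_def by auto
  qed
  have "word_prefix \<sigma> n = u \<longleftrightarrow> (\<forall>k\<in>{1..n}. \<sigma> (id k) = u ! (k - 1))" if "u \<in> words M n" for \<sigma> u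
  proof -
    have "word_prefix \<sigma> n = u \<longleftrightarrow> (\<forall>k<n. \<sigma> (Suc k) = u ! k)"
      using that by (auto simp: words_def word_prefix_def list_eq_iff_nth_eq simp del: upt_Suc)
    also have "\<dots> \<longleftrightarrow> (\<forall>k\<in>{1..n}. \<sigma> (id k) = u ! (k - 1))"
      unfolding image_Suc_lessThan[symmetric] by auto
    finally show ?thesis .
  qed
  then have "Z u = {\<sigma> \<in> space ray_measure. word_prefix \<sigma> n = u}" if "u \<in> S" for u
    unfolding Z_def using assms that by (intro Collect_cong) (metis subsetD)
  then have eq: "{\<sigma> \<in> space ray_measure. word_prefix \<sigma> n \<in> S} = (\<Union>u\<in>S. Z u)"
    by auto
  have S: "finite S" by (rule finite_subset[OF assms finite_words])
  show "{\<sigma> \<in> space ray_measure. word_prefix \<sigma> n \<in> S} \<in> sets ray_measure"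
    unfolding eq using S Z(1) assms by (intro sets.finite_UN) auto
  have "emeasure ray_measure (\<Union>u\<in>S. Z u) \<le> (\<Sum>u\<in>S. emeasure ray_measure (Z u))"
    using S Z(1) assms by (intro emeasure_subadditive_finite) auto
  also have "\<dots> = (\<Sum>u\<in>S. ennreal ((1 / real M) ^ n))"
    using Z(2) assms by (intro sum.cong) auto
  also have "\<dots> = ennreal (real (card S) / real M ^ n)"
    by (simp add: ennreal_mult[symmetric] ennreal_of_nat_eq_real_of_nat power_divide del: ennreal_power)
  finally show "emeasure ray_measure {\<sigma> \<in> space ray_measure. word_prefix \<sigma> n \<in> S} \<le> ennreal (real (card S) / real M ^ n)"
    unfolding eq .
qed

end

text \<open>
  Markov's inequality on the nodes of level \<open>n\<close>: summing over all nodes the number of nodes with the same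
  label word counts the collisions.
\<close>
lemma card_heavy_words_le:
  assumes "0 \<le> L"
  shows "real (card {u \<in> words M n. L < real (label_count M \<omega> (label_word M \<omega> u))}) * L \<le> real (collisions M \<omega> n)"
proof -
  let ?H = "{u \<in> words M n. L < real (label_count M \<omega> (label_word M \<omega> u))}"
  have "real (card ?H) * L = (\<Sum>u\<in>?H. L)" by simp
  also have "\<dots> \<le> (\<Sum>u\<in>?H. real (label_count M \<omega> (label_word M \<omega> u)))"
    by (intro sum_mono) auto
  also have "\<dots> \<le> (\<Sum>u\<in>words M n. real (label_count M \<omega> (label_word M \<omega> u)))"
    by (intro sum_mono2) auto
  finally show ?thesis by (simp add: collisions_def)
qed

text \<open>
  Passes from the discrete scales \<open>r ^ n\<close> to \<^const>\<open>diam_pow\<close>. If \<open>U\<close> has positive diameter, the best scale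
  is the last \<open>n\<close> with \<open>diameter U < r ^ n\<close>, for which \<open>r ^ (n + 1) \<le> diameter U\<close>; this costs the factor
  \<open>1 / r powr t\<close>. If \<open>U\<close> is a single point, all scales are available, and the bounds tend to 0 unless
  \<open>t = 0\<close>.
\<close>
lemma le_diam_pow_of_scales:
  fixes U :: "real set" and x :: ennreal
  assumes r: "0 < r" "r < 1" and t: "0 \<le> t" and U: "bounded U" "U \<noteq> {}" "diameter U < r ^ n0"
    and le: "\<And>n. n0 \<le> n \<Longrightarrow> diameter U < r ^ n \<Longrightarrow> x \<le> ennreal (2 * (r powr t) ^ n)"
  shows "x \<le> ennreal (2 / r powr t) * diam_pow t U"
proof (cases "0 < diameter U")
  case True
  obtain n' where n': "r ^ n' \<le> diameter U" using real_arch_pow_inv[OF True r(2)] less_imp_le by blast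
  define m where "m = (LEAST m. r ^ m \<le> diameter U)"
  have m: "r ^ m \<le> diameter U" unfolding m_def using n' by (rule LeastI)
  have "n0 < m"
  proof (rule ccontr)
    assume "\<not> n0 < m"
    then have "r ^ n0 \<le> r ^ m" using r by (intro power_decreasing) auto
    then show False using m U(3) by simp
  qed
  then obtain n where n: "m = Suc n" "n0 \<le> n" by (cases m) auto
  have "diameter U < r ^ n"
    using not_less_Least[of n "\<lambda>m. r ^ m \<le> diameter U"] n unfolding m_def by simp
  then have "x \<le> ennreal (2 * (r powr t) ^ n)" using le n by simp
  also have "\<dots> \<le> ennreal (2 / r powr t * diameter U powr t)"
  proof (rule ennreal_leI)
    have "(r powr t) ^ m = (r ^ m) powr t"
      using r by (simp add: powr_realpow[symmetric] powr_powr mult.commute)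
    also have "\<dots> \<le> diameter U powr t" using m r t by (intro powr_mono2) auto
    finally have "r powr t * (r powr t) ^ n \<le> diameter U powr t" by (simp add: n)
    then show "2 * (r powr t) ^ n \<le> 2 / r powr t * diameter U powr t"
      using r by (simp add: field_simps)
  qed
  also have "\<dots> = ennreal (2 / r powr t) * ennreal (diameter U powr t)"
    using r by (intro ennreal_mult) auto
  also have "ennreal (diameter U powr t) = diam_pow t U"
    using U(2) True by (simp add: diam_pow_def)
  finally show ?thesis .
next
  case False
  then have d: "diameter U < r ^ n" for n
    using diameter_ge_0[OF U(1)] r by (simp add: not_less)
  show ?thesis
  proof (cases "t = 0")
    case True
    then show ?thesis using le[OF order_refl d] U(2) r by (simp add: diam_pow_def)
  next
    case False
    then have "r powr t < 1" using powr_less_mono2[of t r 1] r t by simp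
    then have "(\<lambda>n. 2 * (r powr t) ^ n) \<longlonglongrightarrow> 2 * 0"
      by (intro tendsto_mult tendsto_const LIMSEQ_power_zero) auto
    then have "(\<lambda>n. ennreal (2 * (r powr t) ^ n)) \<longlonglongrightarrow> ennreal (2 * 0)"
      by (rule tendsto_ennrealI)
    then have "x \<le> ennreal (2 * 0)"
      by (rule LIMSEQ_le_const) (use le d in auto)
    then show ?thesis by simp
  qed
qed

text \<open>
  One of the two factors \<open>sqrt x ^ n\<close> of \<open>x ^ n\<close> absorbs the polynomial.
\<close>
lemma summable_cubic_times_geometric:
  fixes x :: real
  assumes "0 < x" "x < 1"
  shows "summable (\<lambda>n. real (n + 1) ^ 3 * x ^ n)"
proof (rule summable_comparison_test_bigo)
  have "sqrt x < 1" "0 < sqrt x" using assms by auto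
  then show "summable (\<lambda>n. norm (sqrt x ^ n))" by (simp add: summable_geometric)
  have "(\<lambda>n. real (n + 1) ^ 3 * sqrt x ^ n) \<longlonglongrightarrow> 0"
    using \<open>sqrt x < 1\<close> \<open>0 < sqrt x\<close> by real_asymp
  then have "(\<lambda>n. real (n + 1) ^ 3 * sqrt x ^ n) \<in> O(\<lambda>_. 1)"
    by (intro bigoI_tendsto[where c = 0]) auto
  then have "(\<lambda>n. (real (n + 1) ^ 3 * sqrt x ^ n) * sqrt x ^ n) \<in> O(\<lambda>n. 1 * sqrt x ^ n)"
    by (intro landau_o.big.mult) auto
  moreover have "sqrt x ^ n * sqrt x ^ n = x ^ n" for n
    using assms by (simp add: power_mult_distrib[symmetric])
  ultimately show "(\<lambda>n. real (n + 1) ^ 3 * x ^ n) \<in> O(\<lambda>n. sqrt x ^ n)"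
    by (simp add: mult.assoc)
qed

context ordered_ifs
begin

lemma cells_along_ray:
  assumes "\<omega> \<in> {1..} \<rightarrow> {1..N}" "\<sigma> \<in> {1..} \<rightarrow> {1..M}"
  shows "\<exists>x. {x} = (\<Inter>n\<in>{1..}. cell (label_word M \<omega> (word_prefix \<sigma> n)))"
proof -
  define S where "S n = cell (label_word M \<omega> (word_prefix \<sigma> n))" for n
  have W: "label_word M \<omega> (word_prefix \<sigma> n) \<in> words N n" for n
    using label_word_in_words[OF assms(1) word_prefix_in_words[OF assms(2)]] .
  have S_eq: "\<exists>c. S n = {c .. c + r ^ n}" for n
  proof -
    have "label_word M \<omega> (word_prefix \<sigma> n) \<in> lists {1..N}" using W[of n] by (simp add: words_def)
    from cell_eq[OF this] show ?thesis unfolding S_def by auto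
  qed
  have step: "S (Suc n) \<subseteq> S n" for n
  proof -
    have eq: "label_word M \<omega> (word_prefix \<sigma> (Suc n)) =
        label_word M \<omega> (word_prefix \<sigma> n) @ [edge_label M \<omega> (word_prefix \<sigma> (Suc n))]"
      unfolding label_word_word_prefix by simp
    then have "[edge_label M \<omega> (word_prefix \<sigma> (Suc n))] \<in> lists {1..N}"
      using W[of "Suc n"] unfolding words_def by simp
    then show ?thesis unfolding S_def eq by (rule cell_append_subset)
  qed
  have anti: "S n \<subseteq> S m" if "m \<le> n" for m n
    using step that by (rule lift_Suc_antimono_le)
  have "\<exists>x. \<Inter>(range (\<lambda>n. S (Suc n))) = {x}"
  proof (rule decreasing_closed_nest_sing)
    fix n
    obtain c where c: "S (Suc n) = {c .. c + r ^ Suc n}" using S_eq by blast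
    show "closed (S (Suc n))" using c by simp
    show "S (Suc n) \<noteq> {}" using c r_pos by simp
  next
    fix e :: real assume "0 < e"
    then obtain n where n: "r ^ n < e" using real_arch_pow_inv r_less_1 by blast
    obtain c where c: "S n = {c .. c + r ^ n}" using S_eq by blast
    have "\<forall>x\<in>S (Suc n). \<forall>y\<in>S (Suc n). dist x y < e"
    proof (intro ballI)
      fix x y assume "x \<in> S (Suc n)" "y \<in> S (Suc n)"
      then have "x \<in> {c .. c + r ^ n}" "y \<in> {c .. c + r ^ n}" using step[of n] c by auto
      then show "dist x y < e" using n by (auto simp: dist_real_def)
    qed
    then show "\<exists>n. \<forall>x\<in>S (Suc n). \<forall>y\<in>S (Suc n). dist x y < e" by blast
  qed (use anti in simp)
  moreover have "range (\<lambda>n. S (Suc n)) = S ` {1..}"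
  proof -
    have "n \<in> range Suc" if "1 \<le> n" for n :: nat using that by (cases n) auto
    then have "{1..} = range Suc" by auto
    then show ?thesis by (simp add: image_image)
  qed
  ultimately show ?thesis unfolding S_def by metis
qed

lemma random_set_point_on_ray:
  assumes "\<omega> \<in> {1..} \<rightarrow> {1..N}" "\<sigma> \<in> {1..} \<rightarrow> {1..M}"
  obtains x where "x \<in> random_set M f \<omega>" "\<And>n. 1 \<le> n \<Longrightarrow> x \<in> cell (label_word M \<omega> (word_prefix \<sigma> n))"
proof -
  obtain x where x: "{x} = (\<Inter>n\<in>{1..}. cell (label_word M \<omega> (word_prefix \<sigma> n)))"
    using cells_along_ray[OF assms] by (elim exE)
  show ?thesis
  proof (rule that)
    show "x \<in> random_set M f \<omega>" unfolding random_set_eq using assms(2) x by (intro CollectI bexI)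
    fix n :: nat assume "1 \<le> n"
    moreover have "x \<in> (\<Inter>n\<in>{1..}. cell (label_word M \<omega> (word_prefix \<sigma> n)))"
      unfolding x[symmetric] by simp
    ultimately show "x \<in> cell (label_word M \<omega> (word_prefix \<sigma> n))" by (meson INT_D atLeast_iff)
  qed
qed

lemma random_set_subset_attractor:
  assumes "is_attractor N f C" "\<omega> \<in> {1..} \<rightarrow> {1..N}"
  shows "random_set M f \<omega> \<subseteq> C"
proof
  fix x assume "x \<in> random_set M f \<omega>"
  then obtain \<sigma> where \<sigma>: "\<sigma> \<in> {1..} \<rightarrow> {1..M}"
    "{x} = (\<Inter>n\<in>{1..}. cell (label_word M \<omega> (word_prefix \<sigma> n)))"
    unfolding random_set_eq by blast
  have W: "label_word M \<omega> (word_prefix \<sigma> n) \<in> words N n" for n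
    using label_word_in_words[OF assms(2) word_prefix_in_words[OF \<sigma>(1)]] .
  have x: "x \<in> cell (label_word M \<omega> (word_prefix \<sigma> n))" if "1 \<le> n" for n
    using \<sigma>(2) that by blast
  show "x \<in> C"
  proof (rule nested_cells_limit_in_attractor[OF assms(1)])
    fix n
    show "\<exists>w\<in>words N n. x \<in> cell w"
    proof (cases "n = 0")
      case True
      have "x \<in> {0..1}" using x[of 1] W[of 1] cell_subset_unit unfolding words_def by blast
      then show ?thesis using True by (intro bexI[of _ "[]"]) (auto simp: words_def)
    next
      case False
      then show ?thesis using x[of n] W[of n] by auto
    qed
  qed
qed

text \<open>
  A set of diameter below \<open>r ^ n\<close> meets at most two cells of level \<open>n\<close>, and a light cell is reached by at most
  \<open>L\<close> nodes.
\<close>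
lemma card_light_words_meeting_le:
  assumes \<omega>: "\<omega> \<in> {1..} \<rightarrow> {1..N}" and U: "bounded U" "diameter U < r ^ n" and "0 \<le> L"
  shows "real (card {u \<in> words M n. real (label_count M \<omega> (label_word M \<omega> u)) \<le> L \<and>
           cell (label_word M \<omega> u) \<inter> U \<noteq> {}}) \<le> 2 * L" (is "real (card ?E) \<le> _")
proof -
  define W where "W = {w \<in> words N n. cell w \<inter> U \<noteq> {} \<and> real (label_count M \<omega> w) \<le> L}"
  have W: "finite W" "card W \<le> 2"
  proof -
    show "finite W" by (simp add: W_def)
    have "card W \<le> card {w \<in> words N n. cell w \<inter> U \<noteq> {}}"
      unfolding W_def by (intro card_mono) auto
    also have "\<dots> \<le> 2" by (rule card_cells_meeting_le_2[OF U])
    finally show "card W \<le> 2" .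
  qed
  have "?E \<subseteq> (\<Union>w\<in>W. {v \<in> words M n. label_word M \<omega> v = w})"
    using label_word_in_words[OF \<omega>] unfolding W_def by blast
  then have "card ?E \<le> card (\<Union>w\<in>W. {v \<in> words M n. label_word M \<omega> v = w})"
    using W(1) by (intro card_mono) auto
  also have "\<dots> \<le> (\<Sum>w\<in>W. card {v \<in> words M n. label_word M \<omega> v = w})"
    by (rule card_UN_le[OF W(1)])
  also have "\<dots> = (\<Sum>w\<in>W. label_count M \<omega> w)"
    by (intro sum.cong) (auto simp: label_count_def W_def words_def)
  finally have "real (card ?E) \<le> real (\<Sum>w\<in>W. label_count M \<omega> w)" by (rule of_nat_mono)
  also have "\<dots> \<le> real (card W) * L"
    unfolding of_nat_sum by (rule sum_bounded_above) (simp add: W_def)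
  also have "\<dots> \<le> 2 * L" using W(2) assms(4) by (intro mult_right_mono) auto
  finally show ?thesis .
qed

text \<open>
  The mass distribution principle for the image of the uniform ray measure under the map that sends a ray
  to its point of the random set. Call a node of level \<open>n\<close> heavy if its label word is shared by more than
  \<open>M ^ n * \<rho> ^ n\<close> nodes, where \<open>\<rho> = r powr t\<close>. The bound on collisions and \<open>N * \<rho> > 1\<close> make the
  masses of the heavy nodes summable, so beyond some level \<open>n0\<close> at least half of the rays meet no heavy node. The rays
  among these whose point lies in a set \<open>U\<close> of small diameter have mass at most
  \<open>(2 / \<rho>) * (diameter U) ^ t\<close>. Hence the sum of the \<open>t\<close>-th powers in a fine cover stays above \<open>\<rho> / 4\<close>.
  
  The argument works with countable intersections of prefix events instead of the preimages of the covering
  sets, which need not be measurable.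
\<close>
lemma hausdorff_measure_random_set_pos:
  assumes M: "1 \<le> M" and \<omega>: "\<omega> \<in> {1..} \<rightarrow> {1..N}" and t: "0 \<le> t" "1 < real N * r powr t"
    and K: "\<And>n. real (collisions M \<omega> n) \<le> K * (real (n + 1) ^ 3 * (real M ^ 2 / real N) ^ n)"
  shows "hausdorff_measure t (random_set M f \<omega>) \<noteq> 0"
proof -
  let ?\<nu> = "label_measure M (\<lambda>_. 1 / real M)"
  define \<rho> where "\<rho> = r powr t"
  have \<rho>: "0 < \<rho>" "1 < real N * \<rho>" using r_pos t by (simp_all add: \<rho>_def)
  define H where "H n = {u \<in> words M n. real M ^ n * \<rho> ^ n < real (label_count M \<omega> (label_word M \<omega> u))}" for n
  define a where "a n = K * (real (n + 1) ^ 3 * (1 / (real N * \<rho>)) ^ n)" for n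
  have H_sub: "H n \<subseteq> words M n" for n by (auto simp: H_def)
  have H_card: "real (card (H n)) / real M ^ n \<le> a n" for n
  proof -
    have "real (card (H n)) * (real M ^ n * \<rho> ^ n) \<le> real (collisions M \<omega> n)"
      unfolding H_def using \<rho> by (intro card_heavy_words_le) simp
    also note K[of n]
    finally show ?thesis
      using M \<rho> N_ge_2 by (simp add: a_def divide_simps power_mult_distrib power2_eq_square mult_ac)
  qed
  have a_nonneg: "0 \<le> a n" for n
    using H_card[of n] by (rule order_trans[rotated]) simp
  have "summable a"
  proof -
    have "0 < 1 / (real N * \<rho>)" "1 / (real N * \<rho>) < 1" using \<rho> by auto
    then have "summable (\<lambda>n. real (n + 1) ^ 3 * (1 / (real N * \<rho>)) ^ n)"
      by (rule summable_cubic_times_geometric)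
    then show ?thesis unfolding a_def by (rule summable_mult)
  qed
  then obtain n0 where "\<forall>n\<ge>n0. norm (\<Sum>i. a (i + n)) < 1 / 2"
    using suminf_exist_split[of "1/2" a] by auto
  then have n0: "(\<Sum>i. a (i + n0)) < 1 / 2" by force
  define B where "B i = {\<sigma> \<in> space ?\<nu>. word_prefix \<sigma> (i + n0) \<in> H (i + n0)}" for i
  have B: "B i \<in> sets ?\<nu>" "emeasure ?\<nu> (B i) \<le> ennreal (a (i + n0))" for i
  proof -
    show "B i \<in> sets ?\<nu>" unfolding B_def by (rule prefix_event_sets[OF M H_sub])
    have "emeasure ?\<nu> (B i) \<le> ennreal (real (card (H (i + n0))) / real M ^ (i + n0))"
      unfolding B_def by (rule emeasure_prefix_event[OF M H_sub])
    also have "\<dots> \<le> ennreal (a (i + n0))" by (intro ennreal_leI H_card)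
    finally show "emeasure ?\<nu> (B i) \<le> ennreal (a (i + n0))" .
  qed
  have "emeasure ?\<nu> (\<Union>i. B i) \<le> (\<Sum>i. emeasure ?\<nu> (B i))"
    using B(1) by (intro emeasure_subadditive_countably) auto
  also have "\<dots> \<le> (\<Sum>i. ennreal (a (i + n0)))" using B(2) by (intro suminf_le) auto
  also have "\<dots> = ennreal (\<Sum>i. a (i + n0))"
    using a_nonneg \<open>summable a\<close> by (intro suminf_ennreal2) (auto simp: summable_iff_shift)
  also have "\<dots> \<le> ennreal (1 / 2)" using n0 by (intro ennreal_leI) simp
  finally have heavy: "emeasure ?\<nu> (\<Union>i. B i) \<le> ennreal (1 / 2)" .

  define E where "E U n = {u \<in> words M n. real (label_count M \<omega> (label_word M \<omega> u)) \<le> real M ^ n * \<rho> ^ n \<and>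
           cell (label_word M \<omega> u) \<inter> U \<noteq> {}}" for U n
  \<comment> \<open>At every level \<open>n \<ge> n0\<close> whose scale \<open>r ^ n\<close> exceeds the diameter of \<open>U\<close>, the ray passes
    through a light node whose cell meets \<open>U\<close>. Level 0 is left out because the random set is defined by
    the positive levels.\<close>
  define R where "R U = {\<sigma> \<in> space ?\<nu>. \<forall>n. n0 \<le> n \<and> 1 \<le> n \<and> diameter U < r ^ n \<longrightarrow> word_prefix \<sigma> n \<in> E U n}" for U
  have E_sub: "E U n \<subseteq> words M n" for U n by (auto simp: E_def)
  have R_sets: "R U \<in> sets ?\<nu>" for U
    unfolding R_def
  proof (rule sets.sets_Collect_countable_All)
    fix n
    show "{\<sigma> \<in> space ?\<nu>. n0 \<le> n \<and> 1 \<le> n \<and> diameter U < r ^ n \<longrightarrow> word_prefix \<sigma> n \<in> E U n} \<in> sets ?\<nu>"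
      using prefix_event_sets[OF M E_sub[of U n]]
      by (cases "n0 \<le> n \<and> 1 \<le> n \<and> diameter U < r ^ n") auto
  qed
  have R_le: "emeasure ?\<nu> (R U) \<le> ennreal (2 / \<rho>) * diam_pow t U"
    if "bounded U" "diameter U < r ^ Suc n0" for U
  proof (cases "U = {}")
    case True
    have "word_prefix \<sigma> (Suc n0) \<in> E U (Suc n0)" if "\<sigma> \<in> R U" for \<sigma>
      using that \<open>diameter U < r ^ Suc n0\<close> unfolding R_def by simp
    then have "R U = {}" using True unfolding E_def by blast
    then show ?thesis by simp
  next
    case False
    show ?thesis unfolding \<rho>_def
    proof (rule le_diam_pow_of_scales[OF r_pos r_less_1 t(1) that(1) False that(2)])
      fix n assume n: "Suc n0 \<le> n" "diameter U < r ^ n"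
      have "emeasure ?\<nu> (R U) \<le> emeasure ?\<nu> {\<sigma> \<in> space ?\<nu>. word_prefix \<sigma> n \<in> E U n}"
        using n unfolding R_def by (intro emeasure_mono prefix_event_sets[OF M E_sub]) auto
      also have "\<dots> \<le> ennreal (real (card (E U n)) / real M ^ n)"
        by (rule emeasure_prefix_event[OF M E_sub])
      also have "\<dots> \<le> ennreal (2 * (real M ^ n * \<rho> ^ n) / real M ^ n)"
        unfolding E_def using \<rho>
        by (intro ennreal_leI divide_right_mono card_light_words_meeting_le[OF \<omega> that(1) n(2)]) auto
      also have "\<dots> = ennreal (2 * (r powr t) ^ n)" using M by (simp add: \<rho>_def)
      finally show "emeasure ?\<nu> (R U) \<le> ennreal (2 * (r powr t) ^ n)" .
    qed
  qed
  \<comment> \<open>Diameter at most \<open>\<delta>\<close> must give the strict inequality at a positive level, hence two steps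
    beyond \<open>n0\<close>.\<close>
  define \<delta> where "\<delta> = r ^ Suc (Suc n0)"
  have \<delta>: "0 < \<delta>" "\<delta> < r ^ Suc n0" using r_pos r_less_1 by (simp_all add: \<delta>_def)
  have cover: "ennreal (\<rho> / 4) \<le> (\<Sum>k. diam_pow t (U k))"
    if U: "random_set M f \<omega> \<subseteq> (\<Union>k. U k)" "\<forall>k. bounded (U k) \<and> diameter (U k) \<le> \<delta>" for U
  proof -
    \<comment> \<open>A ray that avoids all heavy nodes is charged to a covering set that contains its point.\<close>
    have "space ?\<nu> \<subseteq> (\<Union>i. B i) \<union> (\<Union>k. R (U k))"
    proof
      fix \<sigma> assume \<sigma>: "\<sigma> \<in> space ?\<nu>"
      then have "\<sigma> \<in> {1..} \<rightarrow> {1..M}" by (auto simp: space_label_measure PiE_def)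
      from random_set_point_on_ray[OF \<omega> this] obtain x where x: "x \<in> random_set M f \<omega>"
        "\<And>n. 1 \<le> n \<Longrightarrow> x \<in> cell (label_word M \<omega> (word_prefix \<sigma> n))" by blast
      have W: "word_prefix \<sigma> n \<in> words M n" for n
        using word_prefix_in_words[OF \<open>\<sigma> \<in> {1..} \<rightarrow> {1..M}\<close>] .
      obtain k where k: "x \<in> U k" using x U by blast
      show "\<sigma> \<in> (\<Union>i. B i) \<union> (\<Union>k. R (U k))"
      proof (cases "\<sigma> \<in> (\<Union>i. B i)")
        case False
        have "word_prefix \<sigma> n \<in> E (U k) n" if "n0 \<le> n" "1 \<le> n" for n
        proof -
          have "\<sigma> \<notin> B (n - n0)" using False by blast
          then have "word_prefix \<sigma> n \<notin> H n" using \<sigma> that by (simp add: B_def)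
          then show ?thesis using W[of n] x(2)[OF that(2)] k unfolding H_def E_def by auto
        qed
        then have "\<sigma> \<in> R (U k)" using \<sigma> unfolding R_def by blast
        then show ?thesis by blast
      qed simp
    qed
    moreover have "emeasure ?\<nu> (space ?\<nu>) = 1"
      using prob_space_label_measure[OF M refl] by (rule prob_space.emeasure_space_1)
    ultimately have "1 \<le> emeasure ?\<nu> ((\<Union>i. B i) \<union> (\<Union>k. R (U k)))"
      using B(1) R_sets emeasure_mono[of "space ?\<nu>" "(\<Union>i. B i) \<union> (\<Union>k. R (U k))" ?\<nu>] by auto
    also have "\<dots> \<le> emeasure ?\<nu> (\<Union>i. B i) + emeasure ?\<nu> (\<Union>k. R (U k))"
      using B(1) R_sets by (intro emeasure_subadditive) auto
    also have "\<dots> \<le> ennreal (1 / 2) + (\<Sum>k. emeasure ?\<nu> (R (U k)))"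
      using R_sets by (intro add_mono heavy emeasure_subadditive_countably) auto
    also have "\<dots> \<le> ennreal (1 / 2) + (\<Sum>k. ennreal (2 / \<rho>) * diam_pow t (U k))"
      using U(2) \<delta>(2) by (intro add_mono suminf_le R_le) (auto intro: le_less_trans)
    also have "\<dots> = ennreal (1 / 2) + ennreal (2 / \<rho>) * (\<Sum>k. diam_pow t (U k))"
      by simp
    finally have le: "1 \<le> ennreal (1 / 2) + ennreal (2 / \<rho>) * (\<Sum>k. diam_pow t (U k))" .
    show ?thesis
    proof (cases "\<Sum>k. diam_pow t (U k)" rule: ennreal_cases)
      case (real y)
      have "ennreal (1 / 2) + ennreal (2 / \<rho>) * ennreal y = ennreal (1 / 2 + 2 / \<rho> * y)"
        using real(1) \<rho>(1) ennreal_mult[of "2 / \<rho>" y] ennreal_plus[of "1 / 2" "2 / \<rho> * y"] by simp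
      then have "ennreal 1 \<le> ennreal (1 / 2 + 2 / \<rho> * y)"
        using le unfolding real(2) ennreal_1 by (simp only:)
      then have "1 \<le> 1 / 2 + 2 / \<rho> * y" using real \<rho> by (subst (asm) ennreal_le_iff) auto
      then have "\<rho> / 4 \<le> y" using \<rho> by (simp add: field_simps)
      then show ?thesis using real by (simp add: ennreal_leI)
    qed simp
  qed
  have "ennreal (\<rho> / 4) \<le> hausdorff_premeasure t \<delta> (random_set M f \<omega>)"
    unfolding hausdorff_premeasure_def
  proof (rule INF_greatest)
    fix U :: "nat \<Rightarrow> real set"
    assume "U \<in> {U. random_set M f \<omega> \<subseteq> (\<Union>n. U n) \<and> (\<forall>n. bounded (U n) \<and> diameter (U n) \<le> \<delta>)}"
    then show "ennreal (\<rho> / 4) \<le> (\<Sum>n. diam_pow t (U n))" using cover[of U] by simp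
  qed
  also have "\<dots> \<le> hausdorff_measure t (random_set M f \<omega>)"
    unfolding hausdorff_measure_def using \<delta>(1) by (intro SUP_upper) simp
  finally have "ennreal (\<rho> / 4) \<le> hausdorff_measure t (random_set M f \<omega>)" .
  moreover have "0 < ennreal (\<rho> / 4)" using \<rho>(1) by simp
  ultimately show ?thesis by (metis leD)
qed

end

section \<open>The dimension of the random set\<close>

theorem corollary2p6:
  fixes N M :: nat and r :: real and b :: "nat \<Rightarrow> real"
    and f :: "nat \<Rightarrow> real \<Rightarrow> real" and C :: "real set" and p :: "nat \<Rightarrow> real"
  assumes "N \<ge> 2" and "M \<ge> 2" and "M \<ge> N"
    and "0 < r" and "r \<le> 1 / real N"
    and "\<And>i x. i \<in> {1..N} \<Longrightarrow> x \<in> {0..1} \<Longrightarrow> f i x = r * x + b i"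
    and "\<And>i. i \<in> {1..N} \<Longrightarrow> f i \<in> {0..1} \<rightarrow> {0..1}"
    and "disjoint_family_on (\<lambda>i. f i ` {0<..<1}) {1..N}"
    and "\<And>i j x y. i \<in> {1..N} \<Longrightarrow> j \<in> {1..N} \<Longrightarrow> i < j \<Longrightarrow>
           x \<in> f i ` {0..1} \<Longrightarrow> y \<in> f j ` {0..1} \<Longrightarrow> x \<le> y"
    and "is_attractor N f C"
    and "\<And>i. i \<in> {1..N} \<Longrightarrow> p i = 1 / real N"
  shows "AE \<omega> in label_measure N p.
           has_box_dim (random_set M f \<omega>) (hausdorff_dim (random_set M f \<omega>)) \<and>
           hausdorff_dim (random_set M f \<omega>) = hausdorff_dim C \<and>
           hausdorff_dim C = ereal (- (ln (real N) / ln r))"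
proof -
  have "1 / real N < 1" using assms(1) by simp
  then have r1: "r < 1" using assms(5) by linarith
  interpret ordered_ifs N r b f
    by unfold_locales (fact assms r1)+
  define s where "s = - (ln (real N) / ln r)"
  have "1 \<le> N" "1 \<le> M" using assms by auto
  have C: "bounded C" "C \<noteq> {}"
    using assms(10) compact_imp_bounded by (auto simp: is_attractor_def)
  have "hausdorff_dim C \<le> lower_box_dim C" by (rule hausdorff_dim_le_lower_box_dim[OF C])
  also note lower_box_dim_le_upper_box_dim
  also have "upper_box_dim C \<le> ereal s"
    unfolding s_def by (rule upper_box_dim_subset_attractor[OF assms(10) order_refl C(2)])
  finally have dim_C: "hausdorff_dim C \<le> ereal s" .
  have "AE \<omega> in label_measure N p. \<exists>K. \<forall>n.
     real (collisions M \<omega> n) \<le> K * (real (n + 1) ^ 3 * (real M ^ 2 / real N) ^ n)"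
    by (rule AE_collisions_bounded[OF \<open>1 \<le> N\<close> assms(11) assms(3)])
  then show ?thesis
  proof (rule AE_mp, intro AE_I2 impI)
    fix \<omega> assume "\<omega> \<in> space (label_measure N p)"
    then have \<omega>: "\<omega> \<in> {1..} \<rightarrow> {1..N}" by (auto simp: space_label_measure PiE_def)
    assume "\<exists>K. \<forall>n. real (collisions M \<omega> n) \<le> K * (real (n + 1) ^ 3 * (real M ^ 2 / real N) ^ n)"
    then obtain K where K: "\<And>n. real (collisions M \<omega> n) \<le> K * (real (n + 1) ^ 3 * (real M ^ 2 / real N) ^ n)"
      by blast
    let ?F = "random_set M f \<omega>"
    have F_sub: "?F \<subseteq> C" by (rule random_set_subset_attractor[OF assms(10) \<omega>])
    have "(\<lambda>_. 1) \<in> {1..} \<rightarrow> {1..M}" using \<open>1 \<le> M\<close> by auto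
    from random_set_point_on_ray[OF \<omega> this] have F_ne: "?F \<noteq> {}" by blast
    have F_bd: "bounded ?F" using C(1) F_sub by (rule bounded_subset)
    have "ereal s \<le> hausdorff_dim ?F"
    proof (rule hausdorff_dim_ge)
      fix t assume t: "0 \<le> t" "t < s"
      have "1 < real N * r powr t"
      proof -
        have "ln r < 0" using r_pos r1 by simp
        then have "0 < ln (real N) + t * ln r" using t(2) by (simp add: s_def field_simps)
        also have "\<dots> = ln (real N * r powr t)" using N_ge_2 r_pos by (simp add: ln_mult ln_powr)
        finally show ?thesis using N_ge_2 r_pos by (subst (asm) ln_gt_zero_iff) auto
      qed
      then show "hausdorff_measure t ?F \<noteq> 0"
        by (rule hausdorff_measure_random_set_pos[OF \<open>1 \<le> M\<close> \<omega> t(1) _ K])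
    qed
    moreover have "hausdorff_dim ?F \<le> hausdorff_dim C" by (rule hausdorff_dim_mono[OF F_sub])
    moreover have "hausdorff_dim ?F \<le> lower_box_dim ?F"
      by (rule hausdorff_dim_le_lower_box_dim[OF F_bd F_ne])
    moreover have "lower_box_dim ?F \<le> upper_box_dim ?F" by (rule lower_box_dim_le_upper_box_dim)
    moreover have "upper_box_dim ?F \<le> ereal s"
      unfolding s_def by (rule upper_box_dim_subset_attractor[OF assms(10) F_sub F_ne])
    ultimately have dims: "hausdorff_dim ?F = ereal s" "hausdorff_dim C = ereal s"
      "lower_box_dim ?F = ereal s" "upper_box_dim ?F = ereal s"
      using dim_C by order+
    then show "has_box_dim ?F (hausdorff_dim ?F) \<and> hausdorff_dim ?F = hausdorff_dim C \<and>
        hausdorff_dim C = ereal (- (ln (real N) / ln r))"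
      using F_ne F_bd unfolding has_box_dim_def s_def by simp
  qed
qed

end
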